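(* Let $s\in\mathbb{R}$, $0<p<\infty$, $0<q\le\infty$. For $0<\tau<p$, $0<\theta<1$ and $\gamma\in\mathbb{R}$ with $\gamma\ne s$ we have $$\big(f^s_{p,q},\,b^\gamma_{\tau,\tau}\big)_{\theta,\tau_\theta}=b^{(1-\theta)s+\theta\gamma}_{\tau_\theta,\tau_\theta}\qquad\text{with}\qquad\frac1{\tau_\theta}=\frac{1-\theta}{p}+\frac{\theta}{\tau}$$ (with equivalent quasi-norms).
   Context: $\mathcal{D}$ is the set of dyadic cubes $Q_{j,k}=2^{-j}([0,1)^d+k)$, $j\in\mathbb{Z}$, $k\in\mathbb{Z}^d$, of $\mathbb{R}^d$; $|Q|$ is the Lebesgue measure of $Q$; all spaces are spaces of complex sequences $\mathbf{s}=\{s_Q\}_{Q\in\mathcal{D}}$. For $s\in\mathbb{R}$, $0<p<\infty$, $0<r\le\infty$, $f^s_{p,r}$ is the space of $\mathbf{s}$ with $$\|\mathbf{s}\|_{f^s_{p,r}}=\Big\|\Big[\sum_{Q\in\mathcal{D}}\big(|Q|^{-s/d+1/r-1/2}|s_Q|\chi^{(r)}_Q(\cdot)\big)^r\Big]^{1/r}\Big\|_{L^p(\mathbb{R}^d)}<\infty,\qquad\chi^{(r)}_Q=\chi_Q|Q|^{-1/r}$$ (supremum instead of the inner sum, and $1/r=0$, if $r=\infty$). For $s\in\mathbb{R}$, $0<p,r\le\infty$, $b^s_{p,r}$ is the space of $\mathbf{s}$ with $$\|\mathbf{s}\|_{b^s_{p,r}}=\Big[\sum_{j\in\mathbb{Z}}\Big(\sum_{|Q|=2^{-jd}}(|Q|^{-s/d+1/p-1/2}|s_Q|)^p\Big)^{r/p}\Big]^{1/r}<\infty$$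 (obvious modifications if $p$ or $r$ is $\infty$). $(X,Y)_{\theta,\mu}$ denotes the real ($K$-method) interpolation space of the quasi-Banach spaces $X,Y$, both viewed inside $\mathbb{C}^{\mathcal{D}}$. *)

theory Defs
  imports "HOL-Analysis.Analysis"
begin

section \<open>Dyadic cubes\<close>

text \<open>
  The pair \<open>(j, k)\<close> stands for the cube \<open>2\<^sup>-\<^sup>j ([0,1)\<^sup>d + k)\<close>, where \<open>d = CARD('d)\<close>. By
  \<open>inj_dyadic_cube\<close> below, indexing by pairs is the same as indexing by the cubes themselves.
\<close>

type_synonym 'd dyadic = "int \<times> (int ^ 'd)"

type_synonym 'd dyadic_seq = "'d dyadic \<Rightarrow> complex"

fun dyadic_cube :: "('d::finite) dyadic \<Rightarrow> (real ^ 'd) set" where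
  "dyadic_cube (j, k) =
     {x. \<forall>i. 2 powi (-j) * of_int (k $ i) \<le> x $ i \<and> x $ i < 2 powi (-j) * (of_int (k $ i) + 1)}"

definition cube_vol :: "('d::finite) dyadic \<Rightarrow> real" where
  "cube_vol Q = measure lborel (dyadic_cube Q)"

lemma cube_vol_eq: "cube_vol ((j, k) :: ('d::finite) dyadic) = 2 powi (- (j * int CARD('d)))"
proof -
  let ?a = "(\<chi> i. 2 powi (-j) * of_int (k $ i)) :: real ^ 'd"
  let ?b = "(\<chi> i. 2 powi (-j) * (of_int (k $ i) + 1)) :: real ^ 'd"
  have pos: "(2::real) powi (-j) > 0" by simp
  have sub1: "box ?a ?b \<subseteq> dyadic_cube (j, k)"
    by (auto simp: mem_box_cart less_imp_le)
  have sub2: "dyadic_cube (j, k) \<subseteq> cbox ?a ?b"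
    by (auto simp: mem_box_cart less_imp_le)
  have le: "?a $ i \<le> ?b $ i" for i
    using pos by (simp add: distrib_left)
  have ne: "cbox ?a ?b \<noteq> {}"
    using le by (auto simp: interval_ne_empty_cart)
  have content: "measure lborel (cbox ?a ?b) = 2 powi (- (j * int CARD('d)))"
  proof -
    have "measure lborel (cbox ?a ?b) = (\<Prod>i\<in>(UNIV::'d set). (2::real) powi (-j))"
      using ne by (subst content_cbox_cart) (auto simp: algebra_simps)
    also have "\<dots> = ((2::real) powi (-j)) powi (int CARD('d))"
      by simp
    also have "\<dots> = 2 powi ((-j) * int CARD('d))"
      by (simp only: power_int_mult)
    finally show ?thesis by simp
  qed
  have box: "measure lborel (box ?a ?b) = measure lborel (cbox ?a ?b)"
    by (simp add: measure_lborel_box_eq measure_lborel_cbox_eq)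
  have meas: "dyadic_cube (j, k) \<in> sets borel"
    by simp
  have "dyadic_cube (j, k) \<in> fmeasurable lborel"
    using meas sub2 by (intro fmeasurableI2[OF fmeasurable_cbox]) auto
  then have "measure lborel (box ?a ?b) \<le> measure lborel (dyadic_cube (j, k))"
    using sub1 by (intro measure_mono_fmeasurable) auto
  moreover have "measure lborel (dyadic_cube (j, k)) \<le> measure lborel (cbox ?a ?b)"
    using sub2 meas by (intro measure_mono_fmeasurable) auto
  ultimately show ?thesis
    unfolding cube_vol_def using box content by simp
qed

lemma inj_dyadic_cube: "inj (dyadic_cube :: ('d::finite) dyadic \<Rightarrow> (real ^ 'd) set)"
proof (rule injI, clarify)
  fix j j' :: int and k k' :: "int ^ 'd"
  assume eq: "dyadic_cube (j, k) = dyadic_cube (j', k')"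
  then have "cube_vol (j, k) = cube_vol (j', k')"
    by (simp add: cube_vol_def)
  then have "(2::real) powi (- (j * int CARD('d))) = 2 powi (- (j' * int CARD('d)))"
    by (simp only: cube_vol_eq)
  then have "(2::real) powr real_of_int (- (j * int CARD('d))) =
             2 powr real_of_int (- (j' * int CARD('d)))"
    by (simp add: powr_real_of_int' del: of_int_minus of_int_mult)
  then have "real_of_int (- (j * int CARD('d))) = real_of_int (- (j' * int CARD('d)))"
    by (subst (asm) powr_inj) simp_all
  then have jj: "j = j'"
    by (simp only: of_int_eq_iff) simp
  have pos: "(2::real) powi (-j) > 0" by simp
  have in1: "(\<chi> i. 2 powi (-j) * of_int (k $ i)) \<in> dyadic_cube (j, k)"
    and in2: "(\<chi> i. 2 powi (-j) * of_int (k' $ i)) \<in> dyadic_cube (j', k')"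
    using pos unfolding jj by (simp_all add: distrib_left)
  from in1 in2 have "(\<chi> i. 2 powi (-j) * of_int (k $ i)) \<in> dyadic_cube (j, k')"
    and "(\<chi> i. 2 powi (-j) * of_int (k' $ i)) \<in> dyadic_cube (j, k)"
    using eq jj by blast+
  then have "real_of_int (k' $ i) \<le> of_int (k $ i)" "real_of_int (k $ i) \<le> of_int (k' $ i)" for i
    using pos by auto
  then have "k = k'"
    by (simp add: vec_eq_iff order_antisym)
  with jj show "j = j' \<and> k = k'" by simp
qed

section \<open>Sequence spaces\<close>

text \<open>
  Quasi-norms are defined on all sequences and take values in \<open>[0,\<infinity>]\<close>; the corresponding space
  consists of the sequences whose quasi-norm is finite. Exponents in \<open>(0,\<infinity>]\<close> are of type \<open>ennreal\<close>.
\<close>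

text \<open>Power with a positive exponent on \<open>[0,\<infinity>]\<close>.\<close>

definition epowr :: "ennreal \<Rightarrow> real \<Rightarrow> ennreal" where
  "epowr x a = (if x = \<infinity> then \<infinity> else ennreal (enn2real x powr a))"

definition recip :: "ennreal \<Rightarrow> real" where
  "recip r = enn2real (inverse r)"  \<comment> \<open>\<open>1/r\<close>, with \<open>1/\<infinity> = 0\<close>\<close>

definition lq_norm :: "ennreal \<Rightarrow> 'i set \<Rightarrow> ('i \<Rightarrow> ennreal) \<Rightarrow> ennreal" where
  "lq_norm q I u =
     (if q = \<infinity> then (SUP i\<in>I. u i)
      else epowr (\<integral>\<^sup>+ i. epowr (u i) (enn2real q) \<partial>count_space I) (1 / enn2real q))"

definition chi :: "ennreal \<Rightarrow> ('d::finite) dyadic \<Rightarrow> real ^ 'd \<Rightarrow> real" where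
  "chi r Q x = indicator (dyadic_cube Q) x * cube_vol Q powr (- recip r)"

definition f_norm :: "real \<Rightarrow> real \<Rightarrow> ennreal \<Rightarrow> ('d::finite) dyadic_seq \<Rightarrow> ennreal" where
  "f_norm s p r a =
     epowr (\<integral>\<^sup>+ x. epowr
              (lq_norm r UNIV
                (\<lambda>Q. ennreal (cube_vol Q powr (- s / real CARD('d) + recip r - 1 / 2)
                                * cmod (a Q) * chi r Q x)))
              p \<partial>lborel)
           (1 / p)"

definition b_norm :: "real \<Rightarrow> ennreal \<Rightarrow> ennreal \<Rightarrow> ('d::finite) dyadic_seq \<Rightarrow> ennreal" where
  "b_norm s p r a =
     lq_norm r UNIV
       (\<lambda>j::int. lq_norm p {Q. cube_vol Q = 2 powi (- (j * int CARD('d)))}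
         (\<lambda>Q. ennreal (cube_vol Q powr (- s / real CARD('d) + recip p - 1 / 2) * cmod (a Q))))"

definition b_space :: "real \<Rightarrow> ennreal \<Rightarrow> ennreal \<Rightarrow> ('d::finite) dyadic_seq set" where
  "b_space s p r = {a. b_norm s p r a < \<infinity>}"

section \<open>Real interpolation\<close>

text \<open>
  For \<open>t > 0\<close>, decompositions with a summand outside \<open>X\<close> or \<open>Y\<close> contribute \<open>\<infinity>\<close> to the infimum, so
  the K-functional is the usual one on \<open>X + Y\<close> and is \<open>\<infinity>\<close> outside \<open>X + Y\<close>. In particular
  finiteness of \<open>interp_norm\<close> entails membership in \<open>X + Y\<close>.
\<close>

definition K_functional ::
  "(('i \<Rightarrow> complex) \<Rightarrow> ennreal) \<Rightarrow> (('i \<Rightarrow> complex) \<Rightarrow> ennreal) \<Rightarrow> real \<Rightarrow> ('i \<Rightarrow> complex) \<Rightarrow> ennreal"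
  where
  "K_functional NX NY t a = Inf {NX x + ennreal t * NY y | x y. a = (\<lambda>i. x i + y i)}"

definition interp_norm ::
  "real \<Rightarrow> ennreal \<Rightarrow> (('i \<Rightarrow> complex) \<Rightarrow> ennreal) \<Rightarrow> (('i \<Rightarrow> complex) \<Rightarrow> ennreal)
     \<Rightarrow> ('i \<Rightarrow> complex) \<Rightarrow> ennreal"
  where
  "interp_norm \<theta> \<mu> NX NY a =
     (if \<mu> = \<infinity> then (SUP t\<in>{0<..}. ennreal (t powr (- \<theta>)) * K_functional NX NY t a)
      else epowr (\<integral>\<^sup>+ t\<in>{0<..}. epowr (ennreal (t powr (- \<theta>)) * K_functional NX NY t a) (enn2real \<mu>)
                                  * ennreal (1 / t) \<partial>lborel)
                 (1 / enn2real \<mu>))"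

definition interp_space ::
  "real \<Rightarrow> ennreal \<Rightarrow> (('i \<Rightarrow> complex) \<Rightarrow> ennreal) \<Rightarrow> (('i \<Rightarrow> complex) \<Rightarrow> ennreal)
     \<Rightarrow> ('i \<Rightarrow> complex) set"
  where
  "interp_space \<theta> \<mu> NX NY = {a. interp_norm \<theta> \<mu> NX NY a < \<infinity>}"

definition equivalent_on :: "'v set \<Rightarrow> ('v \<Rightarrow> ennreal) \<Rightarrow> ('v \<Rightarrow> ennreal) \<Rightarrow> bool" where
  "equivalent_on V N N' \<longleftrightarrow>
     (\<exists>c C::real. 0 < c \<and> 0 < C \<and> (\<forall>a\<in>V. ennreal c * N a \<le> N' a \<and> N' a \<le> ennreal C * N a))"

end

theory Submission
  imports Defs
begin

text \<open>
  Put \<open>d = CARD('d)\<close>, \<open>e = (\<gamma> - s) / d * \<tau> / (p - \<tau>)\<close>, \<open>w\<^sub>Q = |Q| powr (e - s / d - 1/2) * |a\<^sub>Q|\<close> and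
  \<open>M\<^sub>Q = |Q| powr (1 - e * p)\<close>. Then \<open>b\<^sup>\<gamma>\<close> and the target space are the \<open>\<ell>\<close>-spaces of \<open>w\<close> with weights \<open>M\<close>
  and exponents \<open>\<tau>\<close> and \<open>r = \<tau>\<theta>\<close>, and the entries of the \<open>f\<close>-norm are \<open>|Q| powr (-e) * w\<^sub>Q\<close>. At a given
  point one cube of each generation contributes, so for \<open>e \<noteq> 0\<close> the sums involved are lacunary and
  the \<open>f\<close>-norm resembles the \<open>\<ell>\<close>-norm of exponent \<open>p\<close>: it dominates its weak version, and where
  \<open>w \<le> l\<close> its \<open>p\<close>-th power is at most a multiple of \<open>l powr (p - p') * (\<Sum>Q. M\<^sub>Q * w\<^sub>Q powr p')\<close>
  for each \<open>p' < p\<close>, whatever \<open>q\<close> is.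

  These two properties suffice. With \<open>1/\<alpha> = 1/\<tau> - 1/p\<close>, a level \<open>l\<close> with \<open>M(w > l) > t powr -\<alpha>\<close>
  satisfies \<open>l \<le> c * t powr (\<alpha>/p) * K(t)\<close>; conversely, if a smoothed distribution function \<open>\<Phi>\<close> has
  \<open>\<Phi> l \<le> t powr -\<alpha>\<close>, then splitting \<open>a\<close> at height \<open>l\<close> gives \<open>t powr (\<alpha>/p) * K(t) \<le> c * l\<close>. Integrating
  over the \<open>(t, l)\<close>-plane by Tonelli turns both into the comparison of the interpolation norm with
  \<open>\<Sum>Q. M\<^sub>Q * w\<^sub>Q powr r\<close>.
\<close>

section \<open>Powers and layer-cake integrals on \<open>[0,\<infinity>]\<close>\<close>

lemma epowr_ennreal [simp]: "0 \<le> x \<Longrightarrow> epowr (ennreal x) a = ennreal (x powr a)"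
  by (simp add: epowr_def)

lemma epowr_top [simp]: "epowr \<infinity> a = \<infinity>" "epowr top a = top"
  by (simp_all add: epowr_def)

lemma epowr_0 [simp]: "epowr 0 a = 0"
  by (simp add: epowr_def)

lemma epowr_mono:
  assumes "0 < a" "x \<le> y" shows "epowr x a \<le> epowr y a"
proof (cases "y = \<infinity>")
  case False
  with assms have "x \<noteq> \<infinity>" by (auto simp: top_unique)
  moreover from assms False have "enn2real x \<le> enn2real y"
    by (simp add: enn2real_mono top.not_eq_extremum)
  ultimately show ?thesis
    using False assms by (simp add: epowr_def powr_mono2 ennreal_leI)
qed simp

lemma epowr_mult:
  assumes "0 < a" shows "epowr (x * y) a = epowr x a * epowr y a"
proof (cases "x = 0 \<or> y = 0")
  case False
  then show ?thesis
    by (cases x; cases y)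
       (auto simp: powr_mult ennreal_mult'[symmetric] ennreal_top_mult ennreal_mult_top)
qed auto

lemma epowr_epowr: "epowr (epowr x a) b = epowr x (a * b)"
  by (cases x) (simp_all add: powr_powr)

lemma epowr_1 [simp]: "epowr x 1 = x"
  by (cases x) simp_all

lemma epowr_le_cancel:
  assumes "0 < a" "epowr x a \<le> epowr y a" shows "x \<le> y"
  using epowr_mono[of "1/a" "epowr x a" "epowr y a"] assms by (simp add: epowr_epowr)

section \<open>Power integrals and layer-cake formulas\<close>

lemma nn_integral_powr_Ioc:
  assumes "0 < r" "0 \<le> c"
  shows "(\<integral>\<^sup>+x. ennreal (r * x powr (r - 1)) * indicator {0<..c} x \<partial>lborel) = ennreal (c powr r)"
proof -
  have "((\<lambda>x. r * x powr (r - 1)) has_integral (r * (c powr (r - 1 + 1) / (r - 1 + 1)))) {0..c}"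
    using assms by (intro has_integral_mult_right has_integral_powr_from_0) auto
  then have "((\<lambda>x. r * x powr (r - 1)) has_integral (c powr r)) {0..c}"
    using assms by simp
  from nn_integral_has_integral_lebesgue[OF _ this]
  have "(\<integral>\<^sup>+x. ennreal (indicator {0..c} x * (r * x powr (r - 1))) \<partial>lborel) = ennreal (c powr r)"
    using assms by simp
  also have "(\<integral>\<^sup>+x. ennreal (indicator {0..c} x * (r * x powr (r - 1))) \<partial>lborel)
    = (\<integral>\<^sup>+x. ennreal (r * x powr (r - 1)) * indicator {0<..c} x \<partial>lborel)"
    by (intro nn_integral_cong) (auto simp: indicator_def)
  finally show ?thesis .
qed

lemma nn_integral_powr_Ici:
  assumes "0 < \<alpha>" "0 < c"
  shows "(\<integral>\<^sup>+t. ennreal (\<alpha> * t powr (-\<alpha> - 1)) * indicator {c..} t \<partial>lborel) = ennreal (c powr -\<alpha>)"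
proof -
  have "((\<lambda>x. \<alpha> * x powr (-\<alpha> - 1)) has_integral (\<alpha> * (- (c powr (-\<alpha> - 1 + 1)) / (-\<alpha> - 1 + 1)))) {c..}"
    using assms by (intro has_integral_mult_right has_integral_powr_to_inf) auto
  then have "((\<lambda>x. \<alpha> * x powr (-\<alpha> - 1)) has_integral (c powr -\<alpha>)) {c..}"
    using assms by simp
  from nn_integral_has_integral_lebesgue[OF _ this]
  have "(\<integral>\<^sup>+x. ennreal (indicator {c..} x * (\<alpha> * x powr (-\<alpha> - 1))) \<partial>lborel) = ennreal (c powr -\<alpha>)"
    using assms by simp
  also have "(\<integral>\<^sup>+x. ennreal (indicator {c..} x * (\<alpha> * x powr (-\<alpha> - 1))) \<partial>lborel)
    = (\<integral>\<^sup>+x. ennreal (\<alpha> * x powr (-\<alpha> - 1)) * indicator {c..} x \<partial>lborel)"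
    by (intro nn_integral_cong) (auto simp: indicator_def)
  finally show ?thesis .
qed

text \<open>One half of the layer-cake formula for \<open>epowr X r\<close>,
  \<open>layer_cake_ge\<close> being the other. The level set uses \<open>\<le>\<close> here and
  \<open><\<close> there, because a lower bound on the K-functional yields
  \<open>ennreal l \<le> X\<close>, while the contrapositive of an upper bound starts from a level
  strictly below \<open>X\<close>.\<close>

lemma layer_cake_le:
  assumes "0 < r"
  shows "(\<integral>\<^sup>+x. ennreal (r * x powr (r - 1)) * indicator {x. 0 < x \<and> ennreal x \<le> X} x \<partial>lborel) \<le> epowr X r"
proof (cases X)
  case (real c)
  then have "{x. 0 < x \<and> ennreal x \<le> X} = {0<..c}" by auto
  then show ?thesis using nn_integral_powr_Ioc[of r c] assms real by simp
qed simp

lemma layer_cake_ge: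
  assumes "0 < r"
  shows "epowr X r \<le> (\<integral>\<^sup>+x. ennreal (r * x powr (r - 1)) * indicator {x. 0 < x \<and> ennreal x < X} x \<partial>lborel)"
    (is "_ \<le> ?I")
proof (rule dense_le)
  \<comment> \<open>Only finite \<open>e\<close> below \<open>epowr X r\<close> are treated, which
    covers an infinite \<open>X\<close> as well; \<open>c\<close> is the level whose
    \<open>r\<close>-th power is \<open>e\<close>.\<close>
  fix e assume e: "e < epowr X r"
  then obtain e' where e': "e = ennreal e'" "0 \<le> e'" by (cases e) auto
  define c where "c = e' powr (1/r)"
  have ce: "c powr r = e'" "0 \<le> c" using e' assms by (auto simp: c_def powr_powr)
  have "ennreal c < X"
  proof (rule ccontr)
    assume "\<not> ennreal c < X"
    then have "epowr X r \<le> epowr (ennreal c) r" using assms by (intro epowr_mono) auto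
    then show False using e e' ce by simp
  qed
  then have "(\<integral>\<^sup>+x. ennreal (r * x powr (r - 1)) * indicator {0<..c} x \<partial>lborel) \<le> ?I"
    by (intro nn_integral_mono) (auto simp: indicator_def intro: le_less_trans ennreal_leI)
  then show "e \<le> ?I" using nn_integral_powr_Ioc[of r c] assms ce e' by simp
qed

text \<open>As \<open>t powr -\<alpha>\<close> decreases, for finite positive \<open>D\<close> the
  condition on \<open>t\<close> cuts out the ray beyond \<open>D powr (-1/\<alpha>)\<close>, over
  which the integral is \<open>D\<close>. This is the counterpart in \<open>t\<close> of the
  layer-cake formula in levels.\<close>

lemma tail_cake:
  assumes "0 < \<alpha>"
  shows "(\<integral>\<^sup>+t. ennreal (\<alpha> * t powr (-\<alpha> - 1)) * indicator {t. 0 < t \<and> ennreal (t powr -\<alpha>) < D} t \<partial>lborel) = D"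
    (is "?I = D")
proof (rule antisym)
  show "?I \<le> D"
  proof (cases "D = top \<or> D = 0")
    case False
    then obtain d where d: "D = ennreal d" "0 < d"
      by (cases D) (auto simp: less_le)
    define c where "c = d powr (-1/\<alpha>)"
    have c: "0 < c" "c powr -\<alpha> = d" using d assms by (auto simp: c_def powr_powr)
    have "c \<le> t" if "0 < t" "t powr -\<alpha> < d" for t
    proof (rule ccontr)
      assume "\<not> c \<le> t"
      then have "c powr -\<alpha> \<le> t powr -\<alpha>" using that assms by (intro powr_mono2') auto
      then show False using that c by simp
    qed
    then have "?I \<le> (\<integral>\<^sup>+t. ennreal (\<alpha> * t powr (-\<alpha> - 1)) * indicator {c..} t \<partial>lborel)"
      by (intro nn_integral_mono) (auto simp: indicator_def d ennreal_less_iff)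
    then show ?thesis using nn_integral_powr_Ici[of \<alpha> c] assms c d by simp
  qed auto
  show "D \<le> ?I"
  proof (rule dense_le)
    fix e assume e: "e < D"
    show "e \<le> ?I"
    proof (cases "e = 0")
      case False
      then obtain e' where e': "e = ennreal e'" "0 < e'" using e by (cases e) (auto simp: less_le top_unique)
      define c where "c = e' powr (-1/\<alpha>)"
      have c: "0 < c" "c powr -\<alpha> = e'" using e' assms by (auto simp: c_def powr_powr)
      have "ennreal (t powr -\<alpha>) < D" if "c \<le> t" for t
      proof -
        have "t powr -\<alpha> \<le> c powr -\<alpha>" using that c assms by (intro powr_mono2') auto
        then show ?thesis using e e' c by (metis ennreal_leI le_less_trans)
      qed
      then have "(\<integral>\<^sup>+t. ennreal (\<alpha> * t powr (-\<alpha> - 1)) * indicator {c..} t \<partial>lborel) \<le> ?I"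
        using c by (intro nn_integral_mono) (auto simp: indicator_def)
      then show ?thesis using nn_integral_powr_Ici[of \<alpha> c] assms c e' by simp
    qed simp
  qed
qed

text \<open>Tonelli on the region \<open>t powr -\<alpha> < D l\<close> of the
  \<open>(t, l)\<close>-plane: integrating over \<open>t\<close> first leaves \<open>D l\<close> by
  \<open>tail_cake\<close>. It carries estimates of the K-functional at each \<open>t\<close> over
  to sums with exponent \<open>r\<close>.\<close>

lemma tail_cake_Fubini:
  fixes D :: "real \<Rightarrow> ennreal"
  assumes "0 < \<alpha>" and [measurable]: "D \<in> borel_measurable borel"
  shows "(\<integral>\<^sup>+t. ennreal (\<alpha> * t powr (-\<alpha> - 1)) * indicator {0<..} t *
            (\<integral>\<^sup>+l. ennreal (r * l powr (r - 1)) * indicator {l. 0 < l \<and> ennreal (t powr -\<alpha>) < D l} l \<partial>lborel) \<partial>lborel)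
      = (\<integral>\<^sup>+l. ennreal (r * l powr (r - 1)) * indicator {0<..} l * D l \<partial>lborel)"
proof -
  define G where "G = (\<lambda>(t::real, l::real). ennreal (\<alpha> * t powr (-\<alpha> - 1)) * indicator {0<..} t *
      (ennreal (r * l powr (r - 1)) * indicator {0<..} l * (if ennreal (t powr -\<alpha>) < D l then 1 else 0)))"
  have [measurable]: "G \<in> borel_measurable (lborel \<Otimes>\<^sub>M lborel)"
    unfolding G_def by measurable
  have "(\<integral>\<^sup>+t. ennreal (\<alpha> * t powr (-\<alpha> - 1)) * indicator {0<..} t *
      (\<integral>\<^sup>+l. ennreal (r * l powr (r - 1)) * indicator {l. 0 < l \<and> ennreal (t powr -\<alpha>) < D l} l \<partial>lborel) \<partial>lborel)
    = (\<integral>\<^sup>+t. \<integral>\<^sup>+l. G (t, l) \<partial>lborel \<partial>lborel)"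
    by (intro nn_integral_cong) (subst nn_integral_cmult[symmetric], measurable,
      auto simp: G_def indicator_def intro!: nn_integral_cong)
  also have "\<dots> = (\<integral>\<^sup>+l. \<integral>\<^sup>+t. G (t, l) \<partial>lborel \<partial>lborel)"
    by (rule lborel_pair.Fubini'[symmetric]) simp
  also have "\<dots> = (\<integral>\<^sup>+l. ennreal (r * l powr (r - 1)) * indicator {0<..} l * D l \<partial>lborel)"
  proof (rule nn_integral_cong)
    fix l :: real
    have "(\<integral>\<^sup>+t. G (t, l) \<partial>lborel) = (\<integral>\<^sup>+t. ennreal (r * l powr (r - 1)) * indicator {0<..} l *
       (ennreal (\<alpha> * t powr (-\<alpha> - 1)) * indicator {t. 0 < t \<and> ennreal (t powr -\<alpha>) < D l} t) \<partial>lborel)"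
      by (intro nn_integral_cong) (auto simp: G_def indicator_def mult_ac)
    also have "\<dots> = ennreal (r * l powr (r - 1)) * indicator {0<..} l * D l"
      by (subst nn_integral_cmult, measurable) (simp add: tail_cake[OF assms(1)])
    finally show "(\<integral>\<^sup>+t. G (t, l) \<partial>lborel) = ennreal (r * l powr (r - 1)) * indicator {0<..} l * D l" .
  qed
  finally show ?thesis .
qed

section \<open>Interpolation of couples of weak type\<close>

text \<open>Countability of the index type makes the counting measure sigma-finite and the integrand
  jointly measurable in index and point.\<close>

lemma borel_measurable_nn_integral_count_space:
  fixes f :: "'i::countable \<Rightarrow> 'a \<Rightarrow> ennreal"
  assumes "\<And>i. f i \<in> borel_measurable N"
  shows "(\<lambda>x. \<integral>\<^sup>+i. f i x \<partial>count_space UNIV) \<in> borel_measurable N"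
proof -
  interpret sigma_finite_measure "count_space (UNIV :: 'i set)"
    by (rule sigma_finite_measure_count_space)
  have "(\<lambda>z. f (snd z) (fst z)) \<in> borel_measurable (N \<Otimes>\<^sub>M count_space UNIV)"
    by (rule measurable_compose_countable) (auto intro: measurable_compose[OF measurable_fst assms])
  then show ?thesis
    by (intro borel_measurable_nn_integral) (simp add: case_prod_unfold)
qed

lemma K_functional_le:
  "K_functional NX NY t (\<lambda>i. x i + y i) \<le> NX x + ennreal t * NY y"
  unfolding K_functional_def by (rule Inf_lower) blast

lemma le_K_functional:
  assumes "\<And>x y. a = (\<lambda>i. x i + y i) \<Longrightarrow> z \<le> NX x + ennreal t * NY y"
  shows "z \<le> K_functional NX NY t a"
  unfolding K_functional_def by (rule Inf_greatest) (use assms in blast)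

text \<open>The model for \<open>NX\<close> is the \<open>M\<close>-weighted norm of
  \<open>W * cmod x\<close> with exponent \<open>p\<close>, where \<open>p' \<le> p\<close>: there
  \<open>weak\<close> is Chebyshev's inequality and \<open>bounded\<close> follows from
  \<open>w powr p \<le> l powr (p - p') * w powr p'\<close>. The locale isolates what the
  interpolation argument uses of the f-norm.\<close>

locale weak_type_couple =
  fixes M W :: "'i::countable \<Rightarrow> real"
    and NX NY :: "('i \<Rightarrow> complex) \<Rightarrow> ennreal"
    and p \<tau> \<theta> r p' C C' :: real
  assumes M_nonneg: "0 \<le> M i" and W_nonneg: "0 \<le> W i"
    and tau: "0 < \<tau>" "\<tau> < p" and theta: "0 < \<theta>" "\<theta> < 1"
    and r_eq: "1 / r = (1 - \<theta>) / p + \<theta> / \<tau>"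
    and p': "r < p'"
    and C: "0 < C" and C': "0 < C'"
    and weak: "0 < l \<Longrightarrow> ennreal (l powr p) *
        (\<integral>\<^sup>+i. ennreal (M i) * indicator {i. l < W i * cmod (x i)} i \<partial>count_space UNIV)
        \<le> ennreal C * epowr (NX x) p"
    and bounded: "0 < l \<Longrightarrow> (\<And>i. W i * cmod (x i) \<le> l) \<Longrightarrow>
        epowr (NX x) p \<le> ennreal (C' * l powr (p - p')) *
        (\<integral>\<^sup>+i. ennreal (M i * (W i * cmod (x i)) powr p') \<partial>count_space UNIV)"
    and NY: "epowr (NY y) \<tau> = (\<integral>\<^sup>+i. ennreal (M i * (W i * cmod (y i)) powr \<tau>) \<partial>count_space UNIV)"
begin

text \<open>With this exponent
  \<open>t * t powr (-\<alpha> / \<tau>) = t powr (-\<alpha> / p)\<close>. Hence, when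
  \<open>a\<close> is split at a level \<open>l\<close> with distribution value about
  \<open>t powr -\<alpha>\<close>, both terms of the K-functional are estimated by multiples of
  \<open>l * t powr (-\<alpha> / p)\<close>.\<close>

definition \<alpha> where "\<alpha> = 1 / (1 / \<tau> - 1 / p)"

text \<open>The distribution function of \<open>W * cmod a\<close> for the measure with point masses
  \<open>M\<close>.\<close>

definition D where
  "D a l = (\<integral>\<^sup>+i. ennreal (M i) * indicator {i. l < W i * cmod (a i)} i \<partial>count_space UNIV)"

text \<open>A distribution function whose sharp cut-off is replaced by power tails; it controls both
  parts of the splitting of \<open>a\<close> at height \<open>l\<close>.\<close>

definition \<Phi> where
  "\<Phi> a l = (\<integral>\<^sup>+i. ennreal (M i * (W i * cmod (a i) / l) powr (if W i * cmod (a i) \<le> l then p' else \<tau>))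
     \<partial>count_space UNIV)"

section \<open>Relations between the exponents\<close>

lemma p_pos: "0 < p" using tau by simp

lemma alpha_pos: "0 < \<alpha>"
  unfolding \<alpha>_def using tau by (simp add: frac_less2)

lemma alpha_tau: "\<alpha> / \<tau> = \<alpha> / p + 1"
proof -
  have "1 / \<tau> - 1 / p > 0" using tau by (simp add: frac_less2)
  then have "\<alpha> * (1 / \<tau> - 1 / p) = 1" unfolding \<alpha>_def by (metis nonzero_divide_eq_eq less_irrefl)
  then show ?thesis by (simp add: algebra_simps)
qed

lemma r_pos: "0 < r"
proof -
  have "1 / r > 0" unfolding r_eq using tau theta p_pos by (intro add_pos_pos) auto
  then show ?thesis by simp
qed

lemma tau_less_r: "\<tau> < r"
proof -
  have "(1 - \<theta>) / p < (1 - \<theta>) / \<tau>" using tau theta by (intro divide_strict_left_mono) auto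
  then have "1 / r < 1 / \<tau>" unfolding r_eq by (simp add: diff_divide_distrib)
  then show ?thesis using tau r_pos by (simp add: field_simps)
qed

text \<open>\<open>1 / r\<close> lies at the fraction \<theta> of the way from \<open>1 / p\<close>
  to \<open>1 / \<tau>\<close>, so \<open>\<alpha> * (1 / r - 1 / p) = \<theta>\<close>. This trades
  the weight \<open>t powr (- \<theta> * r - 1)\<close> of the interpolation norm for
  \<open>t powr (-\<alpha> - 1)\<close>, the one in \<open>tail_cake\<close>, with the K-functional
  rescaled by \<open>t powr (\<alpha> / p)\<close>.\<close>

lemma alpha_r: "\<alpha> * r / p - \<alpha> = - \<theta> * r"
proof -
  have "1/r - 1/p = \<theta> * (1/\<tau> - 1/p)" unfolding r_eq by (simp add: algebra_simps diff_divide_distrib)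
  moreover have "\<alpha> * (1 / \<tau> - 1 / p) = 1" using alpha_tau by (simp add: algebra_simps)
  ultimately have "\<alpha> * (1/r - 1/p) = \<theta>" by (metis mult.assoc mult.commute mult.right_neutral)
  then show ?thesis using r_pos p_pos by (simp add: field_simps)
qed

section \<open>Distribution functions integrated over all levels\<close>

lemma borel_D [measurable]: "D a \<in> borel_measurable borel"
  unfolding D_def[abs_def]
  by (rule borel_measurable_nn_integral_count_space) measurable

lemma borel_Phi [measurable]: "\<Phi> a \<in> borel_measurable borel"
  unfolding \<Phi>_def[abs_def]
  by (rule borel_measurable_nn_integral_count_space) measurable

lemma nn_integral_D:
  "(\<integral>\<^sup>+l. ennreal (r * l powr (r - 1)) * indicator {0<..} l * D a l \<partial>lborel)
   = (\<integral>\<^sup>+i. ennreal (M i * (W i * cmod (a i)) powr r) \<partial>count_space UNIV)"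
proof -
  have eq: "(\<integral>\<^sup>+l. ennreal (r * l powr (r - 1)) * indicator {0<..} l *
           (ennreal (M i) * indicator {i. l < W i * cmod (a i)} i) \<partial>lborel)
      = ennreal (M i * (W i * cmod (a i)) powr r)" (is "?I = _") for i
  proof -
    let ?w = "W i * cmod (a i)"
    have w: "0 \<le> ?w" using W_nonneg by simp
    have "?I = (\<integral>\<^sup>+l. ennreal (M i) * (ennreal (r * l powr (r - 1)) * indicator {0<..?w} l) \<partial>lborel)"
    proof (rule nn_integral_cong_AE)
      \<comment> \<open>Strict and non-strict comparison of \<open>l\<close> with \<open>?w\<close>
        differ only on the null set \<open>{?w}\<close>.\<close>
      show "AE l in lborel. ennreal (r * l powr (r - 1)) * indicator {0<..} l *
           (ennreal (M i) * indicator {i. l < W i * cmod (a i)} i) =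
           ennreal (M i) * (ennreal (r * l powr (r - 1)) * indicator {0<..?w} l)"
        using AE_lborel_singleton[of ?w]
        by eventually_elim (auto simp: indicator_def mult_ac)
    qed
    also have "\<dots> = ennreal (M i) * ennreal (?w powr r)"
      using nn_integral_powr_Ioc[OF r_pos w] by (subst nn_integral_cmult) simp_all
    also have "\<dots> = ennreal (M i * ?w powr r)"
      by (rule ennreal_mult''[symmetric]) simp
    finally show ?thesis .
  qed
  have "(\<integral>\<^sup>+l. ennreal (r * l powr (r - 1)) * indicator {0<..} l * D a l \<partial>lborel)
     = (\<integral>\<^sup>+l. \<integral>\<^sup>+i. ennreal (r * l powr (r - 1)) * indicator {0<..} l *
           (ennreal (M i) * indicator {i. l < W i * cmod (a i)} i) \<partial>count_space UNIV \<partial>lborel)"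
    unfolding D_def by (subst nn_integral_cmult) simp_all
  also have "\<dots> = (\<integral>\<^sup>+i. ennreal (M i * (W i * cmod (a i)) powr r) \<partial>count_space UNIV)"
    by (subst nn_integral_count_space_nn_integral) (simp_all add: eq)
  finally show ?thesis .
qed

text \<open>Index by index: for \<open>l < w\<close> the integrand is a multiple of
  \<open>l powr (r - \<tau> - 1)\<close>, integrable at 0 because \<open>\<tau> < r\<close>; for
  \<open>l \<ge> w\<close> it is a multiple of \<open>l powr (r - p' - 1)\<close>, integrable at
  infinity because \<open>r < p'\<close>. Both pieces scale like \<open>w powr r\<close>, with the
  factors \<open>r / (r - \<tau>)\<close> and \<open>r / (p' - r)\<close>.\<close>

lemma nn_integral_Phi:
  "(\<integral>\<^sup>+l. ennreal (r * l powr (r - 1)) * indicator {0<..} l * \<Phi> a l \<partial>lborel)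
   \<le> ennreal (r / (r - \<tau>) + r / (p' - r)) *
      (\<integral>\<^sup>+i. ennreal (M i * (W i * cmod (a i)) powr r) \<partial>count_space UNIV)"
proof -
  define F where "F = (\<lambda>i l. ennreal (r * l powr (r - 1)) * indicator {0<..} l *
     ennreal (M i * (W i * cmod (a i) / l) powr (if W i * cmod (a i) \<le> l then p' else \<tau>)))"
  have le: "(\<integral>\<^sup>+l. F i l \<partial>lborel) \<le> ennreal (r / (r - \<tau>) + r / (p' - r)) * ennreal (M i * (W i * cmod (a i)) powr r)" for i
  proof (cases "W i * cmod (a i) = 0")
    case True
    then show ?thesis by (auto simp: F_def)
  next
    case False
    define w where "w = W i * cmod (a i)"
    have w: "0 < w" using False W_nonneg[of i] by (simp add: w_def less_le)
    have "F i l \<le> ennreal (M i * w powr \<tau> * r / (r - \<tau>)) * (ennreal ((r - \<tau>) * l powr (r - \<tau> - 1)) * indicator {0<..w} l)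
        + ennreal (M i * w powr p' * r / (p' - r)) * (ennreal ((p' - r) * l powr (-(p' - r) - 1)) * indicator {w..} l)"
        (is "_ \<le> ?A + ?B") for l
    proof -
      consider "l \<le> 0" | "0 < l" "l < w" | "0 < l" "w \<le> l" by linarith
      then show ?thesis
      proof cases
        case 1
        then show ?thesis by (simp add: F_def)
      next
        case 2
        have "F i l = ennreal (r * l powr (r - 1) * (M i * (w / l) powr \<tau>))"
          using 2 r_pos M_nonneg by (simp add: F_def w_def[symmetric] ennreal_mult')
        also have "r * l powr (r - 1) * (M i * (w / l) powr \<tau>) = (M i * w powr \<tau> * r / (r - \<tau>)) * ((r - \<tau>) * l powr (r - \<tau> - 1))"
        proof -
          have "l powr (r - 1) * (w / l) powr \<tau> = w powr \<tau> * l powr (r - \<tau> - 1)"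
            using 2 w by (simp add: powr_divide powr_diff[of l r] powr_diff[of l "r - \<tau>"] mult_ac)
          then show ?thesis using tau_less_r by (simp add: field_simps)
        qed
        also have "ennreal \<dots> = ?A"
          using 2 tau_less_r M_nonneg r_pos by (subst ennreal_mult') auto
        also have "\<dots> \<le> ?A + ?B" by simp
        finally show ?thesis .
      next
        case 3
        have "F i l = ennreal (r * l powr (r - 1) * (M i * (w / l) powr p'))"
          using 3 r_pos M_nonneg by (simp add: F_def w_def[symmetric] ennreal_mult')
        also have "r * l powr (r - 1) * (M i * (w / l) powr p') = (M i * w powr p' * r / (p' - r)) * ((p' - r) * l powr (-(p' - r) - 1))"
        proof -
          have "- (p' - r) - 1 = r - 1 - p'" by simp
          then have "l powr (r - 1) * (w / l) powr p' = w powr p' * l powr (- (p' - r) - 1)"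
            using 3 w by (simp only:) (simp add: powr_divide powr_diff[of l "r - 1"])
          then show ?thesis using p' by (simp add: field_simps)
        qed
        also have "ennreal \<dots> = ?B"
          using 3 p' M_nonneg r_pos by (subst ennreal_mult') auto
        also have "\<dots> \<le> ?A + ?B" by simp
        finally show ?thesis .
      qed
    qed
    then have "(\<integral>\<^sup>+l. F i l \<partial>lborel) \<le> (\<integral>\<^sup>+l. ennreal (M i * w powr \<tau> * r / (r - \<tau>)) * (ennreal ((r - \<tau>) * l powr (r - \<tau> - 1)) * indicator {0<..w} l)
        + ennreal (M i * w powr p' * r / (p' - r)) * (ennreal ((p' - r) * l powr (-(p' - r) - 1)) * indicator {w..} l) \<partial>lborel)"
      by (rule nn_integral_mono)
    also have "\<dots> = ennreal (M i * w powr \<tau> * r / (r - \<tau>)) * ennreal (w powr (r - \<tau>))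
        + ennreal (M i * w powr p' * r / (p' - r)) * ennreal (w powr -(p' - r))"
      using nn_integral_powr_Ioc[of "r - \<tau>" w] nn_integral_powr_Ici[of "p' - r" w] w tau_less_r p'
      by (subst nn_integral_add) (simp_all add: nn_integral_cmult)
    also have "\<dots> = ennreal (M i * w powr \<tau> * r / (r - \<tau>) * w powr (r - \<tau>)
        + M i * w powr p' * r / (p' - r) * w powr -(p' - r))"
      using tau_less_r p' M_nonneg[of i] r_pos by (simp add: ennreal_mult''[symmetric])
    also have "M i * w powr \<tau> * r / (r - \<tau>) * w powr (r - \<tau>)
        + M i * w powr p' * r / (p' - r) * w powr -(p' - r)
        = (r / (r - \<tau>) + r / (p' - r)) * (M i * w powr r)"
    proof -
      have "w powr \<tau> * w powr (r - \<tau>) = w powr r" "w powr p' * w powr (-(p' - r)) = w powr r"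
        by (simp_all add: powr_add[symmetric])
      moreover have "M i * w powr \<tau> * r / (r - \<tau>) * w powr (r - \<tau>)
        + M i * w powr p' * r / (p' - r) * w powr -(p' - r)
        = r / (r - \<tau>) * (M i * (w powr \<tau> * w powr (r - \<tau>)))
        + r / (p' - r) * (M i * (w powr p' * w powr (-(p' - r))))"
        by (simp add: mult_ac)
      ultimately show ?thesis by (simp only: distrib_right)
    qed
    finally show ?thesis
      using tau_less_r p' r_pos M_nonneg[of i] by (subst ennreal_mult'[symmetric]) (auto simp: w_def)
  qed
  have "(\<integral>\<^sup>+l. ennreal (r * l powr (r - 1)) * indicator {0<..} l * \<Phi> a l \<partial>lborel)
     = (\<integral>\<^sup>+l. \<integral>\<^sup>+i. F i l \<partial>count_space UNIV \<partial>lborel)"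
    unfolding \<Phi>_def F_def by (subst nn_integral_cmult) simp_all
  also have "\<dots> = (\<integral>\<^sup>+i. \<integral>\<^sup>+l. F i l \<partial>lborel \<partial>count_space UNIV)"
    by (rule nn_integral_count_space_nn_integral) (simp_all add: F_def)
  also have "\<dots> \<le> (\<integral>\<^sup>+i. ennreal (r / (r - \<tau>) + r / (p' - r)) * ennreal (M i * (W i * cmod (a i)) powr r) \<partial>count_space UNIV)"
    by (intro nn_integral_mono le)
  also have "\<dots> = ennreal (r / (r - \<tau>) + r / (p' - r)) *
      (\<integral>\<^sup>+i. ennreal (M i * (W i * cmod (a i)) powr r) \<partial>count_space UNIV)"
    by (rule nn_integral_cmult) simp
  finally show ?thesis .
qed

lemma interp_norm_powr:
  "epowr (interp_norm \<theta> (ennreal r) NX NY a) r =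
   (\<integral>\<^sup>+t. ennreal (t powr (-\<alpha> - 1)) * indicator {0<..} t *
      epowr (ennreal (t powr (\<alpha> / p)) * K_functional NX NY t a) r \<partial>lborel)"
proof -
  have "epowr (interp_norm \<theta> (ennreal r) NX NY a) r = (\<integral>\<^sup>+ t\<in>{0<..}. epowr (ennreal (t powr (- \<theta>)) * K_functional NX NY t a) r
                                  * ennreal (1 / t) \<partial>lborel)"
    using r_pos by (simp add: interp_norm_def epowr_epowr)
  also have "\<dots> = (\<integral>\<^sup>+t. ennreal (t powr (-\<alpha> - 1)) * indicator {0<..} t *
      epowr (ennreal (t powr (\<alpha> / p)) * K_functional NX NY t a) r \<partial>lborel)"
  proof (rule nn_integral_cong)
    fix t :: real
    show "epowr (ennreal (t powr (- \<theta>)) * K_functional NX NY t a) r * ennreal (1 / t) * indicator {0<..} t =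
      ennreal (t powr (-\<alpha> - 1)) * indicator {0<..} t *
      epowr (ennreal (t powr (\<alpha> / p)) * K_functional NX NY t a) r"
    proof (cases "0 < t")
      case True
      have "t powr (- \<theta> * r) * (1 / t) = t powr (- \<theta> * r - 1)"
        using True by (simp add: powr_diff)
      also have "\<dots> = t powr (- \<alpha> - 1) * t powr (\<alpha> / p * r)"
      proof -
        have "- \<theta> * r - 1 = (- \<alpha> - 1) + \<alpha> / p * r" using alpha_r by (simp add: algebra_simps)
        then show ?thesis by (simp only: powr_add)
      qed
      finally have "ennreal (t powr (- \<theta> * r)) * ennreal (1 / t) = ennreal (t powr (- \<alpha> - 1)) * ennreal (t powr (\<alpha> / p * r))"
        using True by (simp add: ennreal_mult'[symmetric] del: mult_minus_left)
      then show ?thesis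
        using True r_pos
        by (simp add: epowr_mult powr_powr del: mult_minus_left)
          (metis mult.assoc mult.commute)
    qed simp
  qed
  finally show ?thesis .
qed

section \<open>Lower bound for the K-functional\<close>

lemma D_subadd: "D (\<lambda>i. x i + y i) l \<le> D x (l / 2) + D y (l / 2)"
proof -
  have "D (\<lambda>i. x i + y i) l \<le> (\<integral>\<^sup>+i. ennreal (M i) * indicator {i. l/2 < W i * cmod (x i)} i
     + ennreal (M i) * indicator {i. l/2 < W i * cmod (y i)} i \<partial>count_space UNIV)"
    unfolding D_def
  proof (rule nn_integral_mono)
    fix i
    have "W i * cmod (x i + y i) \<le> W i * cmod (x i) + W i * cmod (y i)"
      unfolding distrib_left[symmetric] by (intro mult_left_mono norm_triangle_ineq W_nonneg)
    then show "ennreal (M i) * indicator {i. l < W i * cmod (x i + y i)} i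
       \<le> ennreal (M i) * indicator {i. l/2 < W i * cmod (x i)} i
         + ennreal (M i) * indicator {i. l/2 < W i * cmod (y i)} i"
      by (auto simp: indicator_def)
  qed
  then show ?thesis unfolding D_def by (simp add: nn_integral_add)
qed

lemma D_NY: "0 < l \<Longrightarrow> ennreal (l powr \<tau>) * D y l \<le> epowr (NY y) \<tau>"
  unfolding D_def NY
  by (subst nn_integral_cmult[symmetric], simp, rule nn_integral_mono)
    (auto simp: indicator_def ennreal_mult''[symmetric] M_nonneg mult.commute[of "ennreal (l powr \<tau>)"] tau less_imp_le
      intro!: ennreal_leI mult_left_mono powr_mono2)

text \<open>Common form of the two cases of \<open>le_K\<close>: a weak-type bound with exponent
  \<open>\<sigma>\<close> is solved for the level. The \<open>2\<close> in the constant undoes the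
  halving of \<open>t powr -\<alpha>\<close>.\<close>

lemma le_from_tail:
  assumes "0 < t" "0 < l" "0 < \<sigma>" "0 < B" and d: "ennreal (t powr -\<alpha> / 2) \<le> d"
    and le: "ennreal (l powr \<sigma>) * d \<le> ennreal B * epowr N \<sigma>"
  shows "ennreal l \<le> ennreal ((2 * B) powr (1 / \<sigma>) * t powr (\<alpha> / \<sigma>)) * N"
proof (rule epowr_le_cancel)
  show "0 < \<sigma>" by fact
  have "ennreal (l powr \<sigma>) = ennreal (2 * t powr \<alpha>) * (ennreal (l powr \<sigma>) * ennreal (t powr -\<alpha> / 2))"
    using assms by (simp add: ennreal_mult'[symmetric] powr_minus)
  also have "\<dots> \<le> ennreal (2 * t powr \<alpha>) * (ennreal B * epowr N \<sigma>)"
    by (intro mult_left_mono order_trans[OF _ le] d) auto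
  also have "\<dots> = ennreal (((2 * B) powr (1 / \<sigma>) * t powr (\<alpha> / \<sigma>)) powr \<sigma>) * epowr N \<sigma>"
  proof -
    have "((2 * B) powr (1 / \<sigma>) * t powr (\<alpha> / \<sigma>)) powr \<sigma> = 2 * t powr \<alpha> * B"
      using assms by (simp add: powr_mult powr_powr)
    then show ?thesis using assms by (simp add: ennreal_mult' mult.assoc)
  qed
  finally show "epowr (ennreal l) \<sigma> \<le> epowr (ennreal ((2 * B) powr (1 / \<sigma>) * t powr (\<alpha> / \<sigma>)) * N) \<sigma>"
    using assms by (simp add: epowr_mult)
qed

text \<open>The outer \<open>2\<close> undoes the halved level \<open>l / 2\<close>; the maximum
  covers the constants of \<open>le_from_tail\<close> for \<open>\<sigma> = p\<close>,
  \<open>B = C\<close> and for \<open>\<sigma> = \<tau>\<close>, \<open>B = 1\<close>.\<close>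

definition c0 where "c0 = 2 * max ((2 * C) powr (1 / p)) (2 powr (1 / \<tau>))"

lemma c0_pos: "0 < c0"
  unfolding c0_def by (simp add: less_max_iff_disj)

text \<open>In any decomposition one summand carries at least half of the tail at level
  \<open>l / 2\<close>. The weak-type bound for \<open>NX\<close> or Chebyshev's inequality for
  \<open>NY\<close> then bounds \<open>l\<close>. In the second case
  \<open>t powr (\<alpha> / \<tau>) = t powr (\<alpha> / p) * t\<close>, and the last factor is the
  weight of \<open>NY\<close> in the K-functional.\<close>

lemma le_K:
  assumes t: "0 < t" and l: "0 < l" and lt: "ennreal (t powr -\<alpha>) < D a l"
  shows "ennreal l \<le> ennreal c0 * (ennreal (t powr (\<alpha> / p)) * K_functional NX NY t a)"
proof -
  define k where "k = c0 * t powr (\<alpha> / p)"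
  have k: "0 < k" using c0_pos t by (simp add: k_def)
  have "ennreal (l / k) \<le> K_functional NX NY t a"
  proof (rule le_K_functional)
    fix x y assume a: "a = (\<lambda>i. x i + y i)"
    have "ennreal (t powr -\<alpha>) < D x (l / 2) + D y (l / 2)"
      using lt D_subadd[of x y l] unfolding a by (rule less_le_trans)
    then have "ennreal (t powr -\<alpha> / 2) \<le> D x (l / 2) \<or> ennreal (t powr -\<alpha> / 2) \<le> D y (l / 2)"
    proof (rule contrapos_pp)
      assume "\<not> ?thesis"
      then have "D x (l / 2) + D y (l / 2) \<le> ennreal (t powr -\<alpha> / 2) + ennreal (t powr -\<alpha> / 2)"
        by (intro add_mono) auto
      then show "\<not> ennreal (t powr -\<alpha>) < D x (l / 2) + D y (l / 2)"
        by (simp add: ennreal_plus[symmetric] del: ennreal_plus)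
    qed
    then have "ennreal (l / 2) \<le> ennreal (k / 2) * (NX x + ennreal t * NY y)"
    proof
      assume "ennreal (t powr -\<alpha> / 2) \<le> D x (l / 2)"
      from le_from_tail[OF t _ p_pos C this] weak[of "l / 2" x] l
      have "ennreal (l / 2) \<le> ennreal ((2 * C) powr (1 / p) * t powr (\<alpha> / p)) * NX x"
        by (simp add: D_def)
      also have "\<dots> \<le> ennreal (k / 2) * (NX x + ennreal t * NY y)"
        using t by (intro mult_mono ennreal_leI) (auto simp: k_def c0_def intro!: mult_right_mono)
      finally show ?thesis .
    next
      assume "ennreal (t powr -\<alpha> / 2) \<le> D y (l / 2)"
      from le_from_tail[OF t _ tau(1) zero_less_one this] D_NY[of "l / 2" y] l
      have "ennreal (l / 2) \<le> ennreal (2 powr (1 / \<tau>) * t powr (\<alpha> / \<tau>)) * NY y"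
        by simp
      also have "\<dots> = ennreal (2 powr (1 / \<tau>) * t powr (\<alpha> / p)) * (ennreal t * NY y)"
        using t unfolding alpha_tau by (simp add: powr_add ennreal_mult' mult.assoc)
      also have "\<dots> \<le> ennreal (k / 2) * (NX x + ennreal t * NY y)"
        using t by (intro mult_mono ennreal_leI) (auto simp: k_def c0_def intro!: mult_right_mono)
      finally show ?thesis .
    qed
    then have "ennreal (2 / k) * ennreal (l / 2) \<le> ennreal (2 / k) * (ennreal (k / 2) * (NX x + ennreal t * NY y))"
      by (rule mult_left_mono) simp
    then show "ennreal (l / k) \<le> NX x + ennreal t * NY y"
      using k l by (simp add: mult.assoc[symmetric] ennreal_mult'[symmetric])
  qed
  then have "ennreal k * ennreal (l / k) \<le> ennreal k * K_functional NX NY t a"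
    by (rule mult_left_mono) simp
  also have "ennreal k * ennreal (l / k) = ennreal l"
    using k l by (simp add: ennreal_mult'[symmetric])
  also have "ennreal k = ennreal c0 * ennreal (t powr (\<alpha> / p))"
    using c0_pos by (simp add: k_def ennreal_mult')
  finally show ?thesis by (simp only: mult.assoc)
qed

section \<open>Upper bound for the K-functional\<close>

definition c1 where "c1 = C' powr (1 / p) + 1"

text \<open>Cutting \<open>a\<close> at height \<open>l\<close> gives a small part \<open>x\<close>
  and a large part \<open>y\<close>. The sums bounding \<open>NX x\<close> and \<open>NY y\<close>
  each keep one branch of \<open>\<Phi> a l\<close>, up to the factors \<open>l powr p'\<close> and
  \<open>l powr \<tau>\<close>. The two summands of \<open>c1\<close> come from \<open>x\<close> and
  from \<open>y\<close>.\<close>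

lemma K_le:
  assumes t: "0 < t" and l: "0 < l" and le: "\<Phi> a l \<le> ennreal (t powr -\<alpha>)"
  shows "ennreal (t powr (\<alpha> / p)) * K_functional NX NY t a \<le> ennreal (c1 * l)"
proof -
  define x where "x = (\<lambda>i. if W i * cmod (a i) \<le> l then a i else 0)"
  define y where "y = (\<lambda>i. if W i * cmod (a i) \<le> l then 0 else a i)"
  have "epowr (NX x) p \<le> ennreal (C' * l powr (p - p')) *
        (\<integral>\<^sup>+i. ennreal (M i * (W i * cmod (x i)) powr p') \<partial>count_space UNIV)"
    using l by (intro bounded) (auto simp: x_def)
  also have "(\<integral>\<^sup>+i. ennreal (M i * (W i * cmod (x i)) powr p') \<partial>count_space UNIV)
      \<le> (\<integral>\<^sup>+i. ennreal (l powr p') * ennreal (M i * (W i * cmod (a i) / l) powr (if W i * cmod (a i) \<le> l then p' else \<tau>)) \<partial>count_space UNIV)"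
    using l W_nonneg M_nonneg
    by (intro nn_integral_mono) (auto simp: x_def powr_divide ennreal_mult'[symmetric])
  also have "\<dots> = ennreal (l powr p') * \<Phi> a l"
    unfolding \<Phi>_def by (rule nn_integral_cmult) simp
  also have "ennreal (C' * l powr (p - p')) * (ennreal (l powr p') * \<Phi> a l)
     \<le> ennreal (C' * l powr (p - p')) * (ennreal (l powr p') * ennreal (t powr -\<alpha>))"
    by (intro mult_left_mono le) auto
  also have "\<dots> = epowr (ennreal (C' powr (1 / p) * l * t powr (- \<alpha> / p))) p"
    using l C' p_pos by (simp add: powr_mult powr_powr ennreal_mult'[symmetric] powr_diff)
  finally have "epowr (NX x) p \<le> epowr (ennreal (C' powr (1 / p) * l * t powr (- \<alpha> / p))) p"
    by (simp add: mult_left_mono)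
  then have X: "NX x \<le> ennreal (C' powr (1 / p) * l * t powr (- \<alpha> / p))"
    using p_pos by (rule epowr_le_cancel[rotated])
  have "epowr (NY y) \<tau> = (\<integral>\<^sup>+i. ennreal (M i * (W i * cmod (y i)) powr \<tau>) \<partial>count_space UNIV)"
    by (rule NY)
  also have "\<dots> \<le> (\<integral>\<^sup>+i. ennreal (l powr \<tau>) * ennreal (M i * (W i * cmod (a i) / l) powr (if W i * cmod (a i) \<le> l then p' else \<tau>)) \<partial>count_space UNIV)"
    using l W_nonneg M_nonneg
    by (intro nn_integral_mono) (auto simp: y_def powr_divide ennreal_mult'[symmetric])
  also have "\<dots> = ennreal (l powr \<tau>) * \<Phi> a l"
    unfolding \<Phi>_def by (rule nn_integral_cmult) simp
  also have "\<dots> \<le> ennreal (l powr \<tau>) * ennreal (t powr -\<alpha>)"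
    by (intro mult_left_mono le) auto
  also have "\<dots> = epowr (ennreal (l * t powr (- \<alpha> / \<tau>))) \<tau>"
    using l tau by (simp add: powr_mult powr_powr ennreal_mult'[symmetric])
  finally have Y: "NY y \<le> ennreal (l * t powr (- \<alpha> / \<tau>))"
    using tau by (auto intro: epowr_le_cancel)
  have tt: "t * t powr (- \<alpha> / \<tau>) = t powr (- \<alpha> / p)"
  proof -
    have "- \<alpha> / p = 1 + - \<alpha> / \<tau>" using alpha_tau by simp
    then show ?thesis using t by (simp add: powr_mult_base)
  qed
  have "a = (\<lambda>i. x i + y i)" by (auto simp: x_def y_def)
  then have "K_functional NX NY t a \<le> NX x + ennreal t * NY y"
    using K_functional_le by metis
  also have "\<dots> \<le> ennreal (C' powr (1 / p) * l * t powr (- \<alpha> / p)) + ennreal t * ennreal (l * t powr (- \<alpha> / \<tau>))"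
    by (intro add_mono mult_left_mono X Y) auto
  also have "\<dots> = ennreal (c1 * l * t powr (- \<alpha> / p))"
    using t l tt by (simp add: ennreal_mult'[symmetric] ennreal_plus[symmetric] c1_def algebra_simps del: ennreal_plus)
  finally have "ennreal (t powr (\<alpha> / p)) * K_functional NX NY t a \<le> ennreal (t powr (\<alpha> / p)) * ennreal (c1 * l * t powr (- \<alpha> / p))"
    by (rule mult_left_mono) simp
  also have "\<dots> = ennreal (c1 * l)"
    using t by (simp add: ennreal_mult'[symmetric] powr_minus field_simps)
  finally show ?thesis .
qed

section \<open>Comparison of the interpolation norm with weighted sums\<close>

lemma c1_pos: "0 < c1" unfolding c1_def by (simp add: add_nonneg_pos)

text \<open>For fixed \<open>t\<close>, \<open>le_K\<close> puts every level with
  \<open>t powr -\<alpha> < D a l\<close> below a multiple of the rescaled K-functional, so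
  \<open>H t\<close> is at most a multiple of its \<open>r\<close>-th power. On integration in
  \<open>t\<close>, \<open>tail_cake_Fubini\<close> and \<open>nn_integral_D\<close> produce the
  sum.\<close>

lemma le_interp_norm:
  "ennreal (1 / (\<alpha> * c0 powr r)) * (\<integral>\<^sup>+i. ennreal (M i * (W i * cmod (a i)) powr r) \<partial>count_space UNIV)
   \<le> epowr (interp_norm \<theta> (ennreal r) NX NY a) r"
proof -
  define H where "H t = (\<integral>\<^sup>+l. ennreal (r * l powr (r - 1)) * indicator {l. 0 < l \<and> ennreal (t powr -\<alpha>) < D a l} l \<partial>lborel)" for t
  have [measurable]: "H \<in> borel_measurable borel"
    unfolding H_def by measurable
  have H: "H t \<le> ennreal (c0 powr r) * epowr (ennreal (t powr (\<alpha> / p)) * K_functional NX NY t a) r" if "0 < t" for t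
  proof -
    let ?X = "ennreal c0 * (ennreal (t powr (\<alpha> / p)) * K_functional NX NY t a)"
    have "H t \<le> (\<integral>\<^sup>+x. ennreal (r * x powr (r - 1)) * indicator {x. 0 < x \<and> ennreal x \<le> ?X} x \<partial>lborel)"
      unfolding H_def using le_K[OF that] by (intro nn_integral_mono) (auto simp: indicator_def)
    also have "\<dots> \<le> epowr ?X r" by (rule layer_cake_le[OF r_pos])
    also have "\<dots> = ennreal (c0 powr r) * epowr (ennreal (t powr (\<alpha> / p)) * K_functional NX NY t a) r"
      using c0_pos r_pos by (subst epowr_mult) auto
    finally show ?thesis .
  qed
  have "ennreal (1 / (\<alpha> * c0 powr r)) * (\<integral>\<^sup>+i. ennreal (M i * (W i * cmod (a i)) powr r) \<partial>count_space UNIV)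
    = ennreal (1 / (\<alpha> * c0 powr r)) * (\<integral>\<^sup>+t. ennreal (\<alpha> * t powr (-\<alpha> - 1)) * indicator {0<..} t * H t \<partial>lborel)"
    unfolding nn_integral_D[symmetric] H_def by (subst tail_cake_Fubini[OF alpha_pos]) auto
  also have "\<dots> = (\<integral>\<^sup>+t. ennreal (1 / (\<alpha> * c0 powr r)) * (ennreal (\<alpha> * t powr (-\<alpha> - 1)) * indicator {0<..} t * H t) \<partial>lborel)"
    by (rule nn_integral_cmult[symmetric]) simp
  also have "\<dots> \<le> (\<integral>\<^sup>+t. ennreal (t powr (-\<alpha> - 1)) * indicator {0<..} t *
      epowr (ennreal (t powr (\<alpha> / p)) * K_functional NX NY t a) r \<partial>lborel)"
  proof (rule nn_integral_mono)
    fix t :: real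
    show "ennreal (1 / (\<alpha> * c0 powr r)) * (ennreal (\<alpha> * t powr (-\<alpha> - 1)) * indicator {0<..} t * H t) \<le>
      ennreal (t powr (-\<alpha> - 1)) * indicator {0<..} t *
      epowr (ennreal (t powr (\<alpha> / p)) * K_functional NX NY t a) r"
    proof (cases "0 < t")
      case True
      have "ennreal (1 / (\<alpha> * c0 powr r)) * (ennreal (\<alpha> * t powr (-\<alpha> - 1)) * H t)
         \<le> ennreal (1 / (\<alpha> * c0 powr r)) * (ennreal (\<alpha> * t powr (-\<alpha> - 1)) *
            (ennreal (c0 powr r) * epowr (ennreal (t powr (\<alpha> / p)) * K_functional NX NY t a) r))"
        by (intro mult_left_mono H True) auto
      also have "\<dots> = ennreal (t powr (-\<alpha> - 1)) * epowr (ennreal (t powr (\<alpha> / p)) * K_functional NX NY t a) r"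
        using alpha_pos c0_pos by (simp add: mult.assoc[symmetric] ennreal_mult'[symmetric])
      finally show ?thesis using True by simp
    qed simp
  qed
  finally show ?thesis unfolding interp_norm_powr .
qed

text \<open>By contraposition of \<open>K_le\<close>, every positive level below the rescaled
  K-functional over \<open>c1\<close> satisfies \<open>t powr -\<alpha> < \<Phi> a l\<close>, so a
  multiple of \<open>H t\<close> dominates the \<open>r\<close>-th power.
  \<open>tail_cake_Fubini\<close> leaves the integral of \<open>\<Phi>\<close>, which
  \<open>nn_integral_Phi\<close> estimates.\<close>

lemma interp_norm_le:
  "epowr (interp_norm \<theta> (ennreal r) NX NY a) r \<le>
   ennreal (c1 powr r / \<alpha> * (r / (r - \<tau>) + r / (p' - r))) *
     (\<integral>\<^sup>+i. ennreal (M i * (W i * cmod (a i)) powr r) \<partial>count_space UNIV)"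
proof -
  define H where "H t = (\<integral>\<^sup>+l. ennreal (r * l powr (r - 1)) * indicator {l. 0 < l \<and> ennreal (t powr -\<alpha>) < \<Phi> a l} l \<partial>lborel)" for t
  have [measurable]: "H \<in> borel_measurable borel"
    unfolding H_def by measurable
  have H: "epowr (ennreal (t powr (\<alpha> / p)) * K_functional NX NY t a) r \<le> ennreal (c1 powr r) * H t" if t: "0 < t" for t
  proof -
    let ?K = "ennreal (t powr (\<alpha> / p)) * K_functional NX NY t a"
    let ?X = "ennreal (1 / c1) * ?K"
    have K: "?K = ennreal c1 * ?X"
      using c1_pos by (simp add: mult.assoc[symmetric] ennreal_mult'[symmetric])
    have lt: "ennreal (t powr -\<alpha>) < \<Phi> a l" if "0 < l" "ennreal l < ?X" for l
    proof (rule ccontr)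
      assume "\<not> ?thesis"
      then have "?K \<le> ennreal (c1 * l)" using K_le[OF t \<open>0 < l\<close>, of a] by simp
      then have "?X \<le> ennreal (1 / c1) * ennreal (c1 * l)" by (intro mult_left_mono) auto
      also have "\<dots> = ennreal l" using c1_pos by (simp add: ennreal_mult'[symmetric])
      finally show False using that by simp
    qed
    have "epowr ?X r \<le> (\<integral>\<^sup>+x. ennreal (r * x powr (r - 1)) * indicator {x. 0 < x \<and> ennreal x < ?X} x \<partial>lborel)"
      by (rule layer_cake_ge[OF r_pos])
    also have "\<dots> \<le> H t"
      unfolding H_def using lt by (intro nn_integral_mono) (auto simp: indicator_def)
    finally have "ennreal (c1 powr r) * epowr ?X r \<le> ennreal (c1 powr r) * H t"
      by (rule mult_left_mono) simp
    then show ?thesis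
      using c1_pos r_pos by (subst K, subst epowr_mult) auto
  qed
  have "epowr (interp_norm \<theta> (ennreal r) NX NY a) r \<le>
    (\<integral>\<^sup>+t. ennreal (c1 powr r / \<alpha>) * (ennreal (\<alpha> * t powr (-\<alpha> - 1)) * indicator {0<..} t * H t) \<partial>lborel)"
    unfolding interp_norm_powr
  proof (rule nn_integral_mono)
    fix t :: real
    show "ennreal (t powr (-\<alpha> - 1)) * indicator {0<..} t *
      epowr (ennreal (t powr (\<alpha> / p)) * K_functional NX NY t a) r
      \<le> ennreal (c1 powr r / \<alpha>) * (ennreal (\<alpha> * t powr (-\<alpha> - 1)) * indicator {0<..} t * H t)"
    proof (cases "0 < t")
      case True
      have "ennreal (t powr (-\<alpha> - 1)) * epowr (ennreal (t powr (\<alpha> / p)) * K_functional NX NY t a) r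
        \<le> ennreal (t powr (-\<alpha> - 1)) * (ennreal (c1 powr r) * H t)"
        by (intro mult_left_mono H True) auto
      also have "\<dots> = ennreal (c1 powr r / \<alpha>) * (ennreal (\<alpha> * t powr (-\<alpha> - 1)) * H t)"
      proof -
        have "ennreal (t powr (-\<alpha> - 1)) * ennreal (c1 powr r) = ennreal (c1 powr r / \<alpha>) * ennreal (\<alpha> * t powr (-\<alpha> - 1))"
          using alpha_pos by (simp add: ennreal_mult'[symmetric] mult.commute)
        then show ?thesis by (simp only: mult.assoc[symmetric])
      qed
      finally show ?thesis using True by simp
    qed simp
  qed
  also have "\<dots> = ennreal (c1 powr r / \<alpha>) * (\<integral>\<^sup>+t. ennreal (\<alpha> * t powr (-\<alpha> - 1)) * indicator {0<..} t * H t \<partial>lborel)"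
    by (rule nn_integral_cmult) simp
  also have "\<dots> = ennreal (c1 powr r / \<alpha>) *
      (\<integral>\<^sup>+l. ennreal (r * l powr (r - 1)) * indicator {0<..} l * \<Phi> a l \<partial>lborel)"
    unfolding H_def by (subst tail_cake_Fubini[OF alpha_pos]) auto
  also have "\<dots> \<le> ennreal (c1 powr r / \<alpha>) * (ennreal (r / (r - \<tau>) + r / (p' - r)) *
      (\<integral>\<^sup>+i. ennreal (M i * (W i * cmod (a i)) powr r) \<partial>count_space UNIV))"
    by (intro mult_left_mono nn_integral_Phi) simp
  also have "\<dots> = ennreal (c1 powr r / \<alpha> * (r / (r - \<tau>) + r / (p' - r))) *
     (\<integral>\<^sup>+i. ennreal (M i * (W i * cmod (a i)) powr r) \<partial>count_space UNIV)"
    using alpha_pos by (simp add: mult.assoc[symmetric] ennreal_mult'[symmetric] del: ennreal_plus)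
  finally show ?thesis .
qed

end

section \<open>Lacunary sums\<close>

text \<open>Two copies of the naturals cover the integers; 0 is counted twice, hence an
  inequality.\<close>

lemma nn_integral_two_sided_geometric:
  assumes "0 \<le> \<rho>" "\<rho> < (1::real)"
  shows "(\<integral>\<^sup>+(j::int). ennreal (\<rho> ^ nat \<bar>j\<bar>) \<partial>count_space UNIV) \<le> ennreal (2 / (1 - \<rho>))"
proof -
  let ?f = "\<lambda>j::int. ennreal (\<rho> ^ nat \<bar>j\<bar>)"
  have geo: "(\<integral>\<^sup>+(n::nat). ennreal (\<rho> ^ n) \<partial>count_space UNIV) = ennreal (1 / (1 - \<rho>))"
  proof -
    have "(\<lambda>n. ennreal (\<rho> ^ n)) sums ennreal (1 / (1 - \<rho>))"
      using geometric_sums[of \<rho>] assms by (subst sums_ennreal) auto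
    then show ?thesis by (simp add: nn_integral_count_space_nat sums_unique[symmetric])
  qed
  have half: "(\<integral>\<^sup>+j. ?f j * indicator (range g) j \<partial>count_space UNIV) = ennreal (1 / (1 - \<rho>))"
    if "inj g" "\<And>n. nat \<bar>g n\<bar> = n" for g :: "nat \<Rightarrow> int"
  proof -
    have "(\<integral>\<^sup>+j. ?f j * indicator (range g) j \<partial>count_space UNIV) = (\<integral>\<^sup>+j. ?f j \<partial>count_space (range g))"
      by (simp add: nn_integral_count_space_indicator)
    also have "\<dots> = (\<integral>\<^sup>+n. ?f (g n) \<partial>count_space UNIV)"
      by (rule nn_integral_bij_count_space[symmetric]) (simp add: that inj_on_imp_bij_betw)
    finally show ?thesis using that(2) geo by simp
  qed
  have "(\<integral>\<^sup>+j. ?f j \<partial>count_space UNIV)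
      \<le> (\<integral>\<^sup>+j. ?f j * indicator (range int) j + ?f j * indicator (range (\<lambda>n. - int n)) j \<partial>count_space UNIV)"
  proof (rule nn_integral_mono)
    fix j :: int
    have "j \<in> range int \<or> j \<in> range (\<lambda>n. - int n)"
      by (cases j rule: int_cases2) auto
    then show "?f j \<le> ?f j * indicator (range int) j + ?f j * indicator (range (\<lambda>n. - int n)) j"
      by (auto simp: indicator_def)
  qed
  also have "\<dots> = ennreal (1 / (1 - \<rho>)) + ennreal (1 / (1 - \<rho>))"
    by (subst nn_integral_add) (simp_all add: half inj_def)
  also have "\<dots> = ennreal (2 / (1 - \<rho>))"
    using assms by (simp add: ennreal_plus[symmetric] add_divide_distrib[symmetric] del: ennreal_plus)
  finally show ?thesis .
qed

text \<open>The point is that the constant does not depend on \<open>z\<close>. With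
  \<open>z = 2 powr (- \<sigma> * y)\<close> the terms decay geometrically in the distance from
  \<open>j\<close> to \<open>y\<close>, whatever the sign of \<open>\<sigma>\<close>, so
  \<open>z\<close> merely shifts the centre of the series.\<close>

lemma nn_integral_two_sided_powr_bound:
  fixes \<sigma> A B :: real
  assumes "\<sigma> \<noteq> 0" "0 < A" "0 < B"
  obtains C where "0 < C" "\<And>z. 0 < z \<Longrightarrow>
    (\<integral>\<^sup>+(j::int). ennreal (min ((2 powr (\<sigma> * j) * z) powr A) ((2 powr (\<sigma> * j) * z) powr -B)) \<partial>count_space UNIV)
     \<le> ennreal C"
proof -
  define m where "m = min A B"
  define c where "c = m * \<bar>\<sigma>\<bar>"
  define \<rho> where "\<rho> = (2::real) powr -c"
  have m: "0 < m" using assms by (simp add: m_def)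
  then have c: "0 < c" using assms by (simp add: c_def)
  have \<rho>: "0 \<le> \<rho>" "\<rho> < 1" using c by (auto simp: \<rho>_def powr_less_one)
  have key: "(\<integral>\<^sup>+(j::int). ennreal (min ((2 powr (\<sigma> * j) * z) powr A) ((2 powr (\<sigma> * j) * z) powr -B)) \<partial>count_space UNIV)
     \<le> ennreal (2 powr c * (2 / (1 - \<rho>)))" (is "?L \<le> _") if z: "0 < z" for z
  proof -
    \<comment> \<open>\<open>y\<close> solves \<open>2 powr (\<sigma> * y) * z = 1\<close>. Rounding
      it down to \<open>j0\<close> changes distances by less than 1, which costs the factor
      \<open>2 powr c\<close>.\<close>
    define y where "y = - log 2 z / \<sigma>"
    define j0 where "j0 = \<lfloor>y\<rfloor>"
    have le: "min ((2 powr (\<sigma> * j) * z) powr A) ((2 powr (\<sigma> * j) * z) powr -B) \<le> 2 powr c * \<rho> ^ nat \<bar>j - j0\<bar>" for j :: int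
    proof -
      define u where "u = \<sigma> * (j - y)"
      have "2 powr (\<sigma> * j) * z = 2 powr u"
      proof -
        have "u = \<sigma> * j + log 2 z" using assms by (simp add: u_def y_def field_simps)
        then show ?thesis using z by (simp add: powr_add)
      qed
      then have "min ((2 powr (\<sigma> * j) * z) powr A) ((2 powr (\<sigma> * j) * z) powr -B) = min (2 powr (u * A)) (2 powr (- (u * B)))"
        by (simp add: powr_powr)
      also have "\<dots> \<le> 2 powr (- (m * \<bar>u\<bar>))"
      proof (cases "0 \<le> u")
        case True
        then have "m * \<bar>u\<bar> \<le> u * B" using mult_left_mono[of m B u] by (simp add: m_def mult.commute)
        then show ?thesis by (simp add: min.coboundedI2)
      next
        case False
        then have "u * A \<le> u * m" by (simp add: m_def mult_left_mono_neg)
        then show ?thesis using False by (simp add: min.coboundedI1 mult.commute)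
      qed
      also have "\<dots> \<le> 2 powr (c + - c * \<bar>j - j0\<bar>)"
      proof -
        have "\<bar>real_of_int (j - j0)\<bar> - 1 \<le> \<bar>j - y\<bar>"
          unfolding j0_def by linarith
        then have "\<bar>\<sigma>\<bar> * (\<bar>real_of_int (j - j0)\<bar> - 1) \<le> \<bar>u\<bar>"
          unfolding u_def abs_mult by (intro mult_left_mono) auto
        then have "m * (\<bar>\<sigma>\<bar> * (\<bar>real_of_int (j - j0)\<bar> - 1)) \<le> m * \<bar>u\<bar>"
          using m by (intro mult_left_mono) auto
        then show ?thesis by (simp add: c_def algebra_simps)
      qed
      also have "\<dots> = 2 powr c * \<rho> ^ nat \<bar>j - j0\<bar>"
      proof -
        have "\<rho> ^ nat \<bar>j - j0\<bar> = 2 powr (- c * \<bar>j - j0\<bar>)"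
          by (simp add: \<rho>_def powr_powr flip: powr_realpow)
        then show ?thesis by (simp only: powr_add)
      qed
      finally show ?thesis .
    qed
    have "?L \<le> (\<integral>\<^sup>+(j::int). ennreal (2 powr c) * ennreal (\<rho> ^ nat \<bar>j - j0\<bar>) \<partial>count_space UNIV)"
      using \<rho> by (intro nn_integral_mono) (simp add: ennreal_mult'[symmetric] ennreal_leI le)
    also have "\<dots> = ennreal (2 powr c) * (\<integral>\<^sup>+(j::int). ennreal (\<rho> ^ nat \<bar>j - j0\<bar>) \<partial>count_space UNIV)"
      by (rule nn_integral_cmult) simp
    also have "(\<integral>\<^sup>+(j::int). ennreal (\<rho> ^ nat \<bar>j - j0\<bar>) \<partial>count_space UNIV) = (\<integral>\<^sup>+(j::int). ennreal (\<rho> ^ nat \<bar>j\<bar>) \<partial>count_space UNIV)"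
      by (rule nn_integral_bij_count_space) (rule bij_betwI[where g = "\<lambda>j. j + j0"], auto)
    also have "ennreal (2 powr c) * \<dots> \<le> ennreal (2 powr c) * ennreal (2 / (1 - \<rho>))"
      by (intro mult_left_mono nn_integral_two_sided_geometric \<rho>) simp
    also have "\<dots> = ennreal (2 powr c * (2 / (1 - \<rho>)))"
      by (simp add: ennreal_mult'[symmetric])
    finally show ?thesis .
  qed
  show ?thesis
    using \<rho> by (intro that[OF _ key]) auto
qed

text \<open>A lacunary sum is of the order of its largest term, and on \<open>A\<close> the terms
  \<open>2 powr (\<sigma> * p * j)\<close> are at most \<open>(n / l) powr p\<close>.\<close>

lemma lacunary_weak_bound:
  fixes \<sigma> p :: real
  assumes "\<sigma> \<noteq> 0" "0 < p"
  obtains C where "0 < C" "\<And>(A :: int set) n l. 0 < l \<Longrightarrow> (\<And>j::int. j \<in> A \<Longrightarrow> 2 powr (\<sigma> * j) * l \<le> n) \<Longrightarrow>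
     ennreal (l powr p) * (\<integral>\<^sup>+j. ennreal (2 powr (\<sigma> * p * j)) * indicator A j \<partial>count_space UNIV)
     \<le> ennreal (C * n powr p)"
proof -
  obtain C where C: "0 < C" "\<And>z. 0 < z \<Longrightarrow>
    (\<integral>\<^sup>+(j::int). ennreal (min ((2 powr (\<sigma> * j) * z) powr p) ((2 powr (\<sigma> * j) * z) powr -p)) \<partial>count_space UNIV)
     \<le> ennreal C"
    by (rule nn_integral_two_sided_powr_bound[OF assms(1) assms(2) assms(2)]) blast
  show ?thesis
  proof (rule that[OF C(1)])
    fix A :: "int set" and n l :: real
    assume l: "0 < l" and A: "\<And>j. j \<in> A \<Longrightarrow> 2 powr (\<sigma> * j) * l \<le> n"
    show "ennreal (l powr p) * (\<integral>\<^sup>+j. ennreal (2 powr (\<sigma> * p * j)) * indicator A j \<partial>count_space UNIV)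
     \<le> ennreal (C * n powr p)"
    proof (cases "A = {}")
      case False
      then obtain j0 where "j0 \<in> A" by auto
      from less_le_trans[OF _ A[OF this]] have n: "0 < n" using l by simp
      define z where "z = l / n"
      have z: "0 < z" using n l by (simp add: z_def)
      have le: "l powr p * 2 powr (\<sigma> * p * j) \<le> n powr p * min ((2 powr (\<sigma> * j) * z) powr p) ((2 powr (\<sigma> * j) * z) powr -p)"
        if "j \<in> A" for j
      proof -
        \<comment> \<open>On \<open>A\<close> one has \<open>v \<le> 1\<close>, so the minimum in
          the two-sided bound is its first entry \<open>v powr p\<close>.\<close>
        define v where "v = 2 powr (\<sigma> * j) * z"
        have v: "0 < v" "v \<le> 1" using A[OF that] n z by (auto simp: v_def z_def field_simps)
        have "v powr p \<le> v powr -p" using v assms by (intro powr_mono') auto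
        then have "min (v powr p) (v powr -p) = v powr p" by simp
        then show ?thesis using l n unfolding v_def[symmetric]
          by (simp add: v_def z_def powr_mult powr_divide powr_powr mult_ac)
      qed
      have "ennreal (l powr p) * (\<integral>\<^sup>+j. ennreal (2 powr (\<sigma> * p * j)) * indicator A j \<partial>count_space UNIV)
         = (\<integral>\<^sup>+j. ennreal (l powr p) * (ennreal (2 powr (\<sigma> * p * j)) * indicator A j) \<partial>count_space UNIV)"
        by (rule nn_integral_cmult[symmetric]) simp
      also have "\<dots> \<le> (\<integral>\<^sup>+(j::int). ennreal (n powr p) * ennreal (min ((2 powr (\<sigma> * j) * z) powr p) ((2 powr (\<sigma> * j) * z) powr -p)) \<partial>count_space UNIV)"
        using le by (intro nn_integral_mono) (auto simp: indicator_def ennreal_mult'[symmetric] intro!: ennreal_leI)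
      also have "\<dots> = ennreal (n powr p) * (\<integral>\<^sup>+(j::int). ennreal (min ((2 powr (\<sigma> * j) * z) powr p) ((2 powr (\<sigma> * j) * z) powr -p)) \<partial>count_space UNIV)"
        by (rule nn_integral_cmult) simp
      also have "\<dots> \<le> ennreal (n powr p) * ennreal C"
        by (intro mult_left_mono C z) simp
      also have "\<dots> = ennreal (C * n powr p)" by (simp add: ennreal_mult'' mult.commute)
      finally show ?thesis .
    qed simp
  qed
qed

text \<open>A sequence dominated by \<open>T\<close> times a geometric decay on both sides of some
  point has a \<open>q\<close>-sum of at most a multiple of \<open>T powr q\<close>, so
  \<open>q\<close> enters only through the constant. Here \<open>T powr p\<close> is
  \<open>l powr (p - p')\<close> times the sum on the right.\<close>

lemma lacunary_bounded_bound:
  fixes \<sigma> p p' q :: real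
  assumes "\<sigma> \<noteq> 0" "0 < p'" "p' < p" "0 < q"
  obtains C where "0 < C" "\<And>(w :: int \<Rightarrow> real) l. 0 < l \<Longrightarrow> (\<And>j::int. 0 \<le> w j) \<Longrightarrow> (\<And>j. w j \<le> l) \<Longrightarrow>
     epowr (\<integral>\<^sup>+j. ennreal ((2 powr (\<sigma> * j) * w j) powr q) \<partial>count_space UNIV) (p / q)
     \<le> ennreal (C * l powr (p - p')) * (\<integral>\<^sup>+j. ennreal (2 powr (\<sigma> * p * j) * w j powr p') \<partial>count_space UNIV)"
proof -
  \<comment> \<open>A bound on \<open>2 powr (\<sigma> * p * j) * w j powr p'\<close> bounds
    \<open>2 powr (\<sigma> * j) * w j\<close> by a multiple of
    \<open>2 powr (- b * \<sigma> * j)\<close>; \<open>b\<close> is thus the decay rate on the side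
    where the bound from \<open>w j \<le> l\<close> grows.\<close>
  define b where "b = (p - p') / p'"
  have b: "0 < b" using assms by (simp add: b_def)
  obtain C where C: "0 < C" "\<And>z. 0 < z \<Longrightarrow>
    (\<integral>\<^sup>+(j::int). ennreal (min ((2 powr (\<sigma> * j) * z) powr q) ((2 powr (\<sigma> * j) * z) powr -(b * q))) \<partial>count_space UNIV)
     \<le> ennreal C"
    by (rule nn_integral_two_sided_powr_bound[OF assms(1) assms(4) mult_pos_pos[OF b assms(4)]]) blast
  show ?thesis
  proof (rule that[of "C powr (p / q)"])
    show "0 < C powr (p / q)" using C(1) by simp
    fix w :: "int \<Rightarrow> real" and l :: real
    assume l: "0 < l" and w: "\<And>j. 0 \<le> w j" "\<And>j. w j \<le> l"
    define R where "R = (\<integral>\<^sup>+j. ennreal (2 powr (\<sigma> * p * j) * w j powr p') \<partial>count_space UNIV)"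
    show "epowr (\<integral>\<^sup>+j. ennreal ((2 powr (\<sigma> * j) * w j) powr q) \<partial>count_space UNIV) (p / q)
     \<le> ennreal (C powr (p / q) * l powr (p - p')) * (\<integral>\<^sup>+j. ennreal (2 powr (\<sigma> * p * j) * w j powr p') \<partial>count_space UNIV)"
      unfolding R_def[symmetric]
    proof (cases R)
      case top
      then show "epowr (\<integral>\<^sup>+j. ennreal ((2 powr (\<sigma> * j) * w j) powr q) \<partial>count_space UNIV) (p / q)
        \<le> ennreal (C powr (p / q) * l powr (p - p')) * R"
        using C(1) l by (simp add: ennreal_mult_top)
    next
      case (real \<rho>)
      have "ennreal (2 powr (\<sigma> * p * j) * w j powr p') \<le> R" for j
        unfolding R_def by (rule nn_integral_ge_point) simp
      then have le\<rho>: "2 powr (\<sigma> * p * j) * w j powr p' \<le> \<rho>" for j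
        using real by simp
      show "epowr (\<integral>\<^sup>+j. ennreal ((2 powr (\<sigma> * j) * w j) powr q) \<partial>count_space UNIV) (p / q)
        \<le> ennreal (C powr (p / q) * l powr (p - p')) * R"
      proof (cases "\<rho> = 0")
        case True
        then have "w j = 0" for j using le\<rho>[of j] w(1)[of j] by (simp add: mult_le_0_iff)
        then show ?thesis by simp
      next
        case False
        then have \<rho>: "0 < \<rho>" using real by simp
        \<comment> \<open>The two bounds \<open>w j \<le> l\<close> and \<open>2 powr (\<sigma> * p * j) * w j powr p' \<le> \<rho>\<close> balance at
          \<open>2 powr (\<sigma> * j) = 1 / z\<close>, with common value \<open>T\<close>, and decay geometrically on either side.\<close>
        define z where "z = l powr (p' / p) * \<rho> powr (- 1 / p)"
        define T where "T = \<rho> powr (1 / p) * l powr (1 - p' / p)"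
        have z: "0 < z" and T: "0 < T" using l \<rho> by (auto simp: z_def T_def)
        have le: "(2 powr (\<sigma> * j) * w j) powr q \<le> T powr q * min ((2 powr (\<sigma> * j) * z) powr q) ((2 powr (\<sigma> * j) * z) powr -(b * q))" for j
        proof -
          define v where "v = 2 powr (\<sigma> * j) * z"
          have v: "0 < v" using z by (simp add: v_def)
          have "2 powr (\<sigma> * j) * w j \<le> 2 powr (\<sigma> * j) * l" using w by simp
          also have "\<dots> = T * v"
          proof -
            have "T * z = (\<rho> powr (1 / p) * \<rho> powr (- 1 / p)) * (l powr (1 - p' / p) * l powr (p' / p))"
              by (simp add: T_def z_def)
            also have "\<dots> = l" using l \<rho> by (simp flip: powr_add)
            finally show ?thesis by (simp add: v_def mult_ac)
          qed
          finally have 1: "2 powr (\<sigma> * j) * w j \<le> T * v" .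
          have "(2 powr (\<sigma> * j) * w j) powr p' \<le> (T * v powr - b) powr p'"
          proof -
            have "(2 powr (\<sigma> * j) * w j) powr p' = 2 powr (\<sigma> * j * (p' - p)) * (2 powr (\<sigma> * p * j) * w j powr p')"
            proof -
              have "2 powr (\<sigma> * j * (p' - p)) * 2 powr (\<sigma> * p * j) = 2 powr (\<sigma> * j * p')"
                by (simp add: powr_add[symmetric] algebra_simps)
              then show ?thesis using w(1)[of j] by (simp only: mult.assoc[symmetric]) (simp add: powr_mult powr_powr)
            qed
            also have "\<dots> \<le> 2 powr (\<sigma> * j * (p' - p)) * \<rho>"
              by (intro mult_left_mono le\<rho>) simp
            \<comment> \<open>By the choice of \<open>T\<close> and \<open>z\<close> the exponents
              of \<open>\<rho>\<close> add up to 1 and those of \<open>l\<close> to 0.\<close>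
            also have "\<dots> = (T * v powr - b) powr p'"
            proof -
              have bp: "b * p' = p - p'" using assms by (simp add: b_def)
              have "(T * v powr - b) powr p' = T powr p' * v powr (p' - p)"
                using T bp by (simp add: powr_mult powr_powr)
              also have "v powr (p' - p) = 2 powr (\<sigma> * j * (p' - p)) * z powr (p' - p)"
                using z by (simp add: v_def powr_mult powr_powr)
              also have "T powr p' * (2 powr (\<sigma> * j * (p' - p)) * z powr (p' - p))
                = 2 powr (\<sigma> * j * (p' - p)) * (T powr p' * z powr (p' - p))" by simp
              also have "T powr p' * z powr (p' - p) = (\<rho> powr (1 / p * p') * \<rho> powr (- 1 / p * (p' - p))) *
                   (l powr ((1 - p' / p) * p') * l powr (p' / p * (p' - p)))"
                using l \<rho> by (simp add: T_def z_def powr_mult powr_powr)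
              also have "\<dots> = \<rho> powr (1 / p * p' + - 1 / p * (p' - p)) * l powr ((1 - p' / p) * p' + p' / p * (p' - p))"
                by (simp only: powr_add)
              also have "1 / p * p' + - 1 / p * (p' - p) = 1" using assms by (simp add: field_simps)
              also have "(1 - p' / p) * p' + p' / p * (p' - p) = 0" using assms by (simp add: field_simps)
              finally show ?thesis using \<rho> l by simp
            qed
            finally show ?thesis .
          qed
          then have 2: "2 powr (\<sigma> * j) * w j \<le> T * v powr - b"
            using powr_less_mono2[of p' "T * v powr - b" "2 powr (\<sigma> * j) * w j"] assms T by fastforce
          have "(2 powr (\<sigma> * j) * w j) powr q \<le> (T * v) powr q" "(2 powr (\<sigma> * j) * w j) powr q \<le> (T * v powr - b) powr q"
            using 1 2 w(1)[of j] assms by (auto intro!: powr_mono2)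
          then show ?thesis unfolding v_def[symmetric]
            using T v by (simp add: powr_mult powr_powr min_mult_distrib_left)
        qed
        have "(\<integral>\<^sup>+j. ennreal ((2 powr (\<sigma> * j) * w j) powr q) \<partial>count_space UNIV)
          \<le> (\<integral>\<^sup>+(j::int). ennreal (T powr q) * ennreal (min ((2 powr (\<sigma> * j) * z) powr q) ((2 powr (\<sigma> * j) * z) powr -(b * q))) \<partial>count_space UNIV)"
          using le by (intro nn_integral_mono) (auto simp: ennreal_mult'[symmetric] intro!: ennreal_leI)
        also have "\<dots> = ennreal (T powr q) * (\<integral>\<^sup>+(j::int). ennreal (min ((2 powr (\<sigma> * j) * z) powr q) ((2 powr (\<sigma> * j) * z) powr -(b * q))) \<partial>count_space UNIV)"
          by (rule nn_integral_cmult) simp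
        also have "\<dots> \<le> ennreal (T powr q) * ennreal C"
          by (intro mult_left_mono C z) simp
        also have "\<dots> = ennreal (C * T powr q)" by (simp add: ennreal_mult'' mult.commute)
        finally have "epowr (\<integral>\<^sup>+j. ennreal ((2 powr (\<sigma> * j) * w j) powr q) \<partial>count_space UNIV) (p / q)
            \<le> epowr (ennreal (C * T powr q)) (p / q)"
          using assms by (intro epowr_mono) auto
        also have "\<dots> = ennreal (C powr (p / q) * T powr p)"
          using C T assms by (simp add: powr_mult powr_powr)
        also have "T powr p = l powr (p - p') * \<rho>"
        proof -
          have "T powr p = \<rho> powr (1 / p * p) * l powr ((1 - p' / p) * p)"
            using \<rho> l by (simp add: T_def powr_mult powr_powr)
          also have "1 / p * p = 1" using assms by simp
          also have "(1 - p' / p) * p = p - p'" using assms by (simp add: field_simps)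
          finally show ?thesis using \<rho> by simp
        qed
        also have "ennreal (C powr (p / q) * (l powr (p - p') * \<rho>)) = ennreal (C powr (p / q) * l powr (p - p')) * R"
          using real by (simp add: ennreal_mult'[symmetric] mult.assoc)
        finally show ?thesis .
      qed
    qed
  qed
qed

section \<open>The sequence spaces\<close>

definition cube_at :: "real ^ 'd \<Rightarrow> int \<Rightarrow> ('d::finite) dyadic" where
  "cube_at x j = (j, \<chi> i. \<lfloor>2 powi j * x $ i\<rfloor>)"

lemma mem_dyadic_cube_iff: "x \<in> dyadic_cube (j, k) \<longleftrightarrow> (j, k) = cube_at x j"
proof -
  have "2 powi (-j) * of_int m \<le> y \<and> y < 2 powi (-j) * (of_int m + 1) \<longleftrightarrow> m = \<lfloor>2 powi j * y\<rfloor>" for m :: int and y :: real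
  proof -
    have "2 powi (-j) * of_int m \<le> y \<longleftrightarrow> of_int m \<le> 2 powi j * y"
      "y < 2 powi (-j) * (of_int m + 1) \<longleftrightarrow> 2 powi j * y < of_int m + 1"
      by (simp_all add: power_int_minus field_simps)
    then show ?thesis by (auto simp: floor_eq_iff eq_commute[of m])
  qed
  then show ?thesis by (simp add: cube_at_def vec_eq_iff)
qed

lemma mem_cube_at: "x \<in> dyadic_cube (cube_at x j)"
  using mem_dyadic_cube_iff[of x j "snd (cube_at x j)"]
  by (simp add: cube_at_def del: dyadic_cube.simps)

text \<open>\<open>x\<close> lies in exactly one cube of each generation, so at a fixed point a sum
  over cubes becomes a sum over \<open>j\<close>, to which the lacunary bounds apply.\<close>

lemma nn_integral_cubes_at:
  "(\<integral>\<^sup>+Q. g Q * indicator (dyadic_cube Q) x \<partial>count_space UNIV) = (\<integral>\<^sup>+j. g (cube_at x j) \<partial>count_space UNIV)"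
proof -
  have "bij_betw (cube_at x) UNIV {Q. x \<in> dyadic_cube Q}"
  proof (rule bij_betwI[where g = fst])
    show "cube_at x \<in> UNIV \<rightarrow> {Q. x \<in> dyadic_cube Q}"
      by (simp add: mem_cube_at)
    show "cube_at x (fst Q) = Q" if "Q \<in> {Q. x \<in> dyadic_cube Q}" for Q
      using that mem_dyadic_cube_iff[of x "fst Q" "snd Q"] by simp
  qed (auto simp: cube_at_def)
  from nn_integral_bij_count_space[OF this, of g]
  have "(\<integral>\<^sup>+j. g (cube_at x j) \<partial>count_space UNIV) = (\<integral>\<^sup>+Q. g Q * indicator {Q. x \<in> dyadic_cube Q} Q \<partial>count_space UNIV)"
    by (simp add: nn_integral_count_space_indicator)
  also have "\<dots> = (\<integral>\<^sup>+Q. g Q * indicator (dyadic_cube Q) x \<partial>count_space UNIV)"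
    by (intro nn_integral_cong) (auto simp: indicator_def)
  finally show ?thesis by simp
qed

lemma dyadic_cube_borel [measurable]: "dyadic_cube Q \<in> sets borel"
  by (cases Q) simp

lemma cube_vol_pos: "0 < cube_vol Q"
  by (cases Q) (simp only: cube_vol_eq, simp)

lemma cube_vol_powr:
  "cube_vol ((j, k) :: ('d::finite) dyadic) powr b = 2 powr (- (b * real CARD('d)) * j)"
proof -
  have "cube_vol ((j, k) :: 'd dyadic) = 2 powr real_of_int (- (j * int CARD('d)))"
    unfolding cube_vol_eq by (subst powr_real_of_int') simp_all
  then show ?thesis by (simp add: powr_powr mult_ac)
qed

text \<open>\<open>measure\<close> takes the value 0 where \<open>emeasure\<close> is infinite, so
  \<open>cube_vol_pos\<close> excludes that case.\<close>

lemma emeasure_dyadic_cube: "emeasure lborel (dyadic_cube Q) = ennreal (cube_vol Q)"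
  unfolding cube_vol_def
proof (rule emeasure_eq_ennreal_measure)
  show "emeasure lborel (dyadic_cube Q) \<noteq> top"
    using cube_vol_pos[of Q] unfolding cube_vol_def measure_def by auto
qed

section \<open>The quasi-norms as weighted sums and integrals\<close>

lemma le_lq_norm:
  assumes "0 < q" "i \<in> I" shows "u i \<le> lq_norm q I u"
proof (cases "q = \<infinity>")
  case True
  then show ?thesis using assms by (simp add: lq_norm_def SUP_upper)
next
  case False
  then have q: "0 < enn2real q" using assms by (simp add: enn2real_positive_iff top.not_eq_extremum)
  have "epowr (u i) (enn2real q) \<le> (\<integral>\<^sup>+ i. epowr (u i) (enn2real q) \<partial>count_space I)"
    by (rule nn_integral_ge_point) (use assms in auto)
  then have "epowr (epowr (u i) (enn2real q)) (1 / enn2real q) \<le> lq_norm q I u"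
    using False q by (auto simp: lq_norm_def intro!: epowr_mono)
  then show ?thesis using q by (simp add: epowr_epowr)
qed

text \<open>Reduces upper bounds for \<open>q = \<infinity>\<close> to a finite exponent: a supremum
  is at most the sum, so \<open>q0 = 1\<close> serves.\<close>

lemma lq_norm_le_finite:
  assumes "0 < q"
  obtains q0 where "0 < q0" "\<And>u. lq_norm q I u \<le> lq_norm (ennreal q0) I u"
proof (cases "q = \<infinity>")
  case True
  have "lq_norm q I u \<le> lq_norm (ennreal 1) I u" for u
    unfolding True lq_norm_def[of \<infinity>] by (auto intro!: SUP_least le_lq_norm)
  then show ?thesis using that[of 1] by simp
next
  case False
  then have "0 < enn2real q" "ennreal (enn2real q) = q"
    using assms by (auto simp: enn2real_positive_iff top.not_eq_extremum)
  then show ?thesis using that[of "enn2real q"] by simp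
qed

text \<open>With equal inner and outer exponents the inner root cancels, and the sums over
  generations and within a generation merge into one sum over pairs.\<close>

lemma epowr_b_norm:
  fixes a :: "('d::finite) dyadic_seq"
  assumes "0 < r"
  shows "epowr (b_norm \<sigma> (ennreal r) (ennreal r) a) r =
    (\<integral>\<^sup>+Q. ennreal ((cube_vol Q powr (- \<sigma> / real CARD('d) + 1 / r - 1 / 2) * cmod (a Q)) powr r) \<partial>count_space UNIV)"
proof -
  let ?f = "\<lambda>Q. ennreal ((cube_vol Q powr (- \<sigma> / real CARD('d) + 1 / r - 1 / 2) * cmod (a Q)) powr r)"
  have recip: "recip (ennreal r) = 1 / r"
    using assms by (simp add: recip_def inverse_ennreal inverse_eq_divide)
  have powi_inj: "(2::real) powi m = 2 powi n \<longleftrightarrow> m = n" for m n :: int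
    by (metis power_int_strict_increasing linorder_neqE less_irrefl one_less_numeral_iff semiring_norm(76))
  have lev: "{Q :: 'd dyadic. cube_vol Q = 2 powi (- (j * int CARD('d)))} = {j} \<times> UNIV" for j
    by (auto simp: cube_vol_eq powi_inj simp del: power_int_minus)
  have inner: "epowr (lq_norm (ennreal r) {Q. cube_vol Q = 2 powi (- (j * int CARD('d)))}
         (\<lambda>Q. ennreal (cube_vol Q powr (- \<sigma> / real CARD('d) + recip (ennreal r) - 1 / 2) * cmod (a Q)))) r
     = (\<integral>\<^sup>+k. ?f (j, k) \<partial>count_space UNIV)" for j
  proof -
    have "bij_betw (Pair j) UNIV ({j} \<times> UNIV :: 'd dyadic set)"
      by (rule bij_betwI[where g = snd]) auto
    from nn_integral_bij_count_space[OF this, of ?f] show ?thesis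
      using assms by (simp add: lq_norm_def epowr_epowr lev recip)
  qed
  have "epowr (b_norm \<sigma> (ennreal r) (ennreal r) a) r =
     (\<integral>\<^sup>+j. epowr (lq_norm (ennreal r) {Q. cube_vol Q = 2 powi (- (j * int CARD('d)))}
         (\<lambda>Q. ennreal (cube_vol Q powr (- \<sigma> / real CARD('d) + recip (ennreal r) - 1 / 2) * cmod (a Q)))) r \<partial>count_space UNIV)"
    using assms by (simp add: b_norm_def lq_norm_def[of _ "UNIV :: int set"] epowr_epowr)
  also have "\<dots> = (\<integral>\<^sup>+j. \<integral>\<^sup>+k. ?f (j, k) \<partial>count_space UNIV \<partial>count_space UNIV)"
    by (simp only: inner)
  also have "\<dots> = (\<integral>\<^sup>+Q. ?f Q \<partial>count_space UNIV)"
    by (rule nn_integral_fst_count_space)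
  finally show ?thesis .
qed

text \<open>The normalisation of \<open>chi\<close> cancels \<open>recip q\<close>, so the entries
  do not depend on \<open>q\<close>. The free parameter \<open>e\<close> splits off
  \<open>cube_vol Q powr (-e)\<close>, which for \<open>e \<noteq> 0\<close> is the lacunary factor
  at a point.\<close>

lemma epowr_f_norm:
  fixes a :: "('d::finite) dyadic_seq"
  assumes "0 < p"
  shows "epowr (f_norm s p q a) p = (\<integral>\<^sup>+x. epowr (lq_norm q UNIV
      (\<lambda>Q. ennreal (cube_vol Q powr (-e) * (cube_vol Q powr (e - s / real CARD('d) - 1 / 2) * cmod (a Q)))
            * indicator (dyadic_cube Q) x)) p \<partial>lborel)"
proof -
  have "ennreal (cube_vol Q powr (- s / real CARD('d) + recip q - 1 / 2) * cmod (a Q) * chi q Q x)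
    = ennreal (cube_vol Q powr (-e) * (cube_vol Q powr (e - s / real CARD('d) - 1 / 2) * cmod (a Q)))
            * indicator (dyadic_cube Q) x" for Q x
  proof -
    have "cube_vol Q powr (- s / real CARD('d) + recip q - 1 / 2) * cube_vol Q powr (- recip q)
       = cube_vol Q powr (-e) * cube_vol Q powr (e - s / real CARD('d) - 1 / 2)"
      by (simp flip: powr_add)
    then have "cube_vol Q powr (- s / real CARD('d) + recip q - 1 / 2) * cmod (a Q) * cube_vol Q powr (- recip q)
       = cube_vol Q powr (-e) * (cube_vol Q powr (e - s / real CARD('d) - 1 / 2) * cmod (a Q))"
      by (metis mult.assoc mult.commute)
    then show ?thesis by (auto simp: chi_def indicator_def)
  qed
  then show ?thesis using assms by (simp add: f_norm_def epowr_epowr)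
qed

text \<open>At a point the inner norm dominates each single entry, so
  \<open>lacunary_weak_bound\<close> applies to the generations with \<open>w > l\<close>, with
  \<open>n\<close> the value of the inner norm. Integration in \<open>x\<close> contributes a factor
  \<open>cube_vol Q\<close> and thereby produces the weight with exponent
  \<open>1 - e * p\<close>.\<close>

lemma f_norm_weak:
  fixes s e p :: real
  assumes "e \<noteq> 0" "0 < p" "0 < q"
  obtains C where "0 < C" "\<And>(a :: ('d::finite) dyadic_seq) l. 0 < l \<Longrightarrow>
     ennreal (l powr p) * (\<integral>\<^sup>+Q. ennreal (cube_vol Q powr (1 - e * p)) *
         indicator {Q. l < cube_vol Q powr (e - s / real CARD('d) - 1 / 2) * cmod (a Q)} Q \<partial>count_space UNIV)
     \<le> ennreal C * epowr (f_norm s p q a) p"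
proof -
  let ?d = "real CARD('d)"
  define \<sigma> where "\<sigma> = e * ?d"
  have "\<sigma> \<noteq> 0" using assms by (simp add: \<sigma>_def)
  then obtain C where C: "0 < C" "\<And>(A :: int set) n l. 0 < l \<Longrightarrow> (\<And>j::int. j \<in> A \<Longrightarrow> 2 powr (\<sigma> * j) * l \<le> n) \<Longrightarrow>
     ennreal (l powr p) * (\<integral>\<^sup>+j. ennreal (2 powr (\<sigma> * p * j)) * indicator A j \<partial>count_space UNIV)
     \<le> ennreal (C * n powr p)"
    using assms(2) by (rule lacunary_weak_bound) blast
  show ?thesis
  proof (rule that[OF C(1)])
    fix a :: "'d dyadic_seq" and l :: real
    assume l: "0 < l"
    define w where "w Q = cube_vol Q powr (e - s / ?d - 1 / 2) * cmod (a Q)" for Q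
    define N where "N x = lq_norm q UNIV (\<lambda>Q. ennreal (cube_vol Q powr (-e) * w Q) * indicator (dyadic_cube Q) x)" for x
    define S where "S x = (\<integral>\<^sup>+Q. ennreal (cube_vol Q powr (- (e * p))) * indicator {Q. l < w Q} Q * indicator (dyadic_cube Q) x \<partial>count_space UNIV)" for x
    have [measurable]: "S \<in> borel_measurable borel"
      unfolding S_def[abs_def] by (rule borel_measurable_nn_integral_count_space) measurable
    have S_eq: "S x = (\<integral>\<^sup>+j. ennreal (2 powr (\<sigma> * p * j)) * indicator {j. l < w (cube_at x j)} j \<partial>count_space UNIV)" for x
      unfolding S_def nn_integral_cubes_at
      by (intro nn_integral_cong) (simp add: cube_at_def cube_vol_powr \<sigma>_def indicator_def mult_ac)
    \<comment> \<open>The constant stays with \<open>S\<close>, whose measurability is established,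
      so that it can be taken out of the integral.\<close>
    have pt: "ennreal (l powr p / C) * S x \<le> epowr (N x) p" for x
    proof (cases "N x")
      case (real n)
      have "2 powr (\<sigma> * j) * l \<le> n" if "j \<in> {j. l < w (cube_at x j)}" for j
      proof -
        have "ennreal (cube_vol (cube_at x j) powr (-e) * w (cube_at x j)) \<le> N x"
          using le_lq_norm[OF assms(3), of "cube_at x j" UNIV "\<lambda>Q. ennreal (cube_vol Q powr (-e) * w Q) * indicator (dyadic_cube Q) x"]
          by (simp add: N_def mem_cube_at)
        then have "2 powr (\<sigma> * j) * w (cube_at x j) \<le> n"
          using real by (simp add: cube_at_def cube_vol_powr \<sigma>_def)
        moreover have "2 powr (\<sigma> * j) * l \<le> 2 powr (\<sigma> * j) * w (cube_at x j)"
          using that by (intro mult_left_mono) auto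
        ultimately show ?thesis by linarith
      qed
      from C(2)[OF l this] have "ennreal (l powr p) * S x \<le> ennreal (C * n powr p)"
        unfolding S_eq by blast
      then have "ennreal (1 / C) * (ennreal (l powr p) * S x) \<le> ennreal (1 / C) * ennreal (C * n powr p)"
        by (intro mult_left_mono) auto
      then show ?thesis
        using C(1) real by (simp add: mult.assoc[symmetric] ennreal_mult'[symmetric])
    qed simp
    have "(\<integral>\<^sup>+x. S x \<partial>lborel) = (\<integral>\<^sup>+Q. \<integral>\<^sup>+x. ennreal (cube_vol Q powr (- (e * p))) * indicator {Q. l < w Q} Q * indicator (dyadic_cube Q) x \<partial>lborel \<partial>count_space UNIV)"
      unfolding S_def by (rule nn_integral_count_space_nn_integral) auto
    also have "\<dots> = (\<integral>\<^sup>+Q. ennreal (cube_vol Q powr (1 - e * p)) * indicator {Q. l < w Q} Q \<partial>count_space UNIV)"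
    proof (rule nn_integral_cong)
      fix Q :: "'d dyadic"
      have "(\<integral>\<^sup>+x. ennreal (cube_vol Q powr (- (e * p))) * indicator {Q. l < w Q} Q * indicator (dyadic_cube Q) x \<partial>lborel)
        = ennreal (cube_vol Q powr (- (e * p))) * indicator {Q. l < w Q} Q * ennreal (cube_vol Q)"
        by (simp add: nn_integral_cmult_indicator emeasure_dyadic_cube)
      also have "\<dots> = ennreal (cube_vol Q powr (1 - e * p)) * indicator {Q. l < w Q} Q"
        using cube_vol_pos[of Q] by (auto simp: indicator_def ennreal_mult'[symmetric] powr_diff powr_minus divide_inverse mult.commute)
      finally show "(\<integral>\<^sup>+x. ennreal (cube_vol Q powr (- (e * p))) * indicator {Q. l < w Q} Q * indicator (dyadic_cube Q) x \<partial>lborel)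
        = ennreal (cube_vol Q powr (1 - e * p)) * indicator {Q. l < w Q} Q" .
    qed
    finally have "ennreal (l powr p) * (\<integral>\<^sup>+Q. ennreal (cube_vol Q powr (1 - e * p)) * indicator {Q. l < w Q} Q \<partial>count_space UNIV)
       = ennreal C * (ennreal (l powr p / C) * (\<integral>\<^sup>+x. S x \<partial>lborel))"
      using C(1) by (simp add: mult.assoc[symmetric] ennreal_mult'[symmetric])
    also have "\<dots> = ennreal C * (\<integral>\<^sup>+x. ennreal (l powr p / C) * S x \<partial>lborel)"
      by (subst nn_integral_cmult) auto
    also have "\<dots> \<le> ennreal C * (\<integral>\<^sup>+x. epowr (N x) p \<partial>lborel)"
      by (intro mult_left_mono nn_integral_mono pt) simp
    also have "\<dots> = ennreal C * epowr (f_norm s p q a) p"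
      unfolding epowr_f_norm[OF assms(2), where e = e] N_def w_def ..
    finally show "ennreal (l powr p) * (\<integral>\<^sup>+Q. ennreal (cube_vol Q powr (1 - e * p)) *
         indicator {Q. l < cube_vol Q powr (e - s / ?d - 1 / 2) * cmod (a Q)} Q \<partial>count_space UNIV)
     \<le> ennreal C * epowr (f_norm s p q a) p"
      unfolding w_def .
  qed
qed

text \<open>\<open>lacunary_bounded_bound\<close> is applied at each point to the cubes containing
  it, with a finite \<open>q0\<close> in place of \<open>q\<close>, and then integrated over
  \<open>x\<close>.\<close>

lemma f_norm_bounded:
  fixes s e p p' :: real
  assumes "e \<noteq> 0" "0 < p'" "p' < p" "0 < q"
  obtains C where "0 < C" "\<And>(a :: ('d::finite) dyadic_seq) l. 0 < l \<Longrightarrow>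
     (\<And>Q. cube_vol Q powr (e - s / real CARD('d) - 1 / 2) * cmod (a Q) \<le> l) \<Longrightarrow>
     epowr (f_norm s p q a) p \<le> ennreal (C * l powr (p - p')) *
       (\<integral>\<^sup>+Q. ennreal (cube_vol Q powr (1 - e * p) *
         (cube_vol Q powr (e - s / real CARD('d) - 1 / 2) * cmod (a Q)) powr p') \<partial>count_space UNIV)"
proof -
  let ?d = "real CARD('d)"
  define \<sigma> where "\<sigma> = e * ?d"
  have \<sigma>: "\<sigma> \<noteq> 0" using assms by (simp add: \<sigma>_def)
  have p: "0 < p" using assms by simp
  obtain q0 where q0: "0 < q0" "\<And>u. lq_norm q (UNIV :: 'd dyadic set) u \<le> lq_norm (ennreal q0) UNIV u"
    by (rule lq_norm_le_finite[OF assms(4)]) blast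
  obtain C where C: "0 < C" "\<And>(w :: int \<Rightarrow> real) l. 0 < l \<Longrightarrow> (\<And>j::int. 0 \<le> w j) \<Longrightarrow> (\<And>j. w j \<le> l) \<Longrightarrow>
     epowr (\<integral>\<^sup>+j. ennreal ((2 powr (\<sigma> * j) * w j) powr q0) \<partial>count_space UNIV) (p / q0)
     \<le> ennreal (C * l powr (p - p')) * (\<integral>\<^sup>+j. ennreal (2 powr (\<sigma> * p * j) * w j powr p') \<partial>count_space UNIV)"
    by (rule lacunary_bounded_bound[OF \<sigma> assms(2,3) q0(1)]) blast
  show ?thesis
  proof (rule that[OF C(1)])
    fix a :: "'d dyadic_seq" and l :: real
    assume l: "0 < l" and bd: "\<And>Q. cube_vol Q powr (e - s / ?d - 1 / 2) * cmod (a Q) \<le> l"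
    define w where "w Q = cube_vol Q powr (e - s / ?d - 1 / 2) * cmod (a Q)" for Q
    have w: "0 \<le> w Q" "w Q \<le> l" for Q using bd by (simp_all add: w_def)
    define S where "S x = (\<integral>\<^sup>+Q. ennreal (cube_vol Q powr (- (e * p)) * w Q powr p') * indicator (dyadic_cube Q) x \<partial>count_space UNIV)" for x
    have [measurable]: "S \<in> borel_measurable borel"
      unfolding S_def[abs_def] by (rule borel_measurable_nn_integral_count_space) measurable
    have S_eq: "S x = (\<integral>\<^sup>+j. ennreal (2 powr (\<sigma> * p * j) * w (cube_at x j) powr p') \<partial>count_space UNIV)" for x
      unfolding S_def nn_integral_cubes_at
      by (intro nn_integral_cong) (simp add: cube_at_def cube_vol_powr \<sigma>_def mult_ac)
    have pt: "epowr (lq_norm q UNIV (\<lambda>Q. ennreal (cube_vol Q powr (-e) * w Q) * indicator (dyadic_cube Q) x)) p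
      \<le> ennreal (C * l powr (p - p')) * S x" for x
    proof -
      let ?u = "\<lambda>Q. ennreal (cube_vol Q powr (-e) * w Q) * indicator (dyadic_cube Q) x"
      have "epowr (lq_norm q UNIV ?u) p \<le> epowr (lq_norm (ennreal q0) UNIV ?u) p"
        using p by (intro epowr_mono q0)
      also have "\<dots> = epowr (\<integral>\<^sup>+Q. epowr (?u Q) q0 \<partial>count_space UNIV) (p / q0)"
        using q0 by (simp add: lq_norm_def epowr_epowr)
      also have "(\<integral>\<^sup>+Q. epowr (?u Q) q0 \<partial>count_space UNIV)
        = (\<integral>\<^sup>+Q. ennreal ((cube_vol Q powr (-e) * w Q) powr q0) * indicator (dyadic_cube Q) x \<partial>count_space UNIV)"
        using w by (intro nn_integral_cong) (auto simp: indicator_def)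
      also have "\<dots> = (\<integral>\<^sup>+j. ennreal ((2 powr (\<sigma> * j) * w (cube_at x j)) powr q0) \<partial>count_space UNIV)"
        unfolding nn_integral_cubes_at
        by (intro nn_integral_cong) (simp add: cube_at_def cube_vol_powr \<sigma>_def)
      also have "epowr \<dots> (p / q0) \<le> ennreal (C * l powr (p - p')) * S x"
        unfolding S_eq by (intro C(2) l w)
      finally show ?thesis .
    qed
    have "(\<integral>\<^sup>+x. S x \<partial>lborel) = (\<integral>\<^sup>+Q. \<integral>\<^sup>+x. ennreal (cube_vol Q powr (- (e * p)) * w Q powr p') * indicator (dyadic_cube Q) x \<partial>lborel \<partial>count_space UNIV)"
      unfolding S_def by (rule nn_integral_count_space_nn_integral) auto
    also have "\<dots> = (\<integral>\<^sup>+Q. ennreal (cube_vol Q powr (1 - e * p) * w Q powr p') \<partial>count_space UNIV)"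
    proof (rule nn_integral_cong)
      fix Q :: "'d dyadic"
      have "(\<integral>\<^sup>+x. ennreal (cube_vol Q powr (- (e * p)) * w Q powr p') * indicator (dyadic_cube Q) x \<partial>lborel)
        = ennreal (cube_vol Q powr (- (e * p)) * w Q powr p') * ennreal (cube_vol Q)"
        by (simp add: nn_integral_cmult_indicator emeasure_dyadic_cube)
      also have "\<dots> = ennreal (cube_vol Q powr (1 - e * p) * w Q powr p')"
        using cube_vol_pos[of Q] by (auto simp: ennreal_mult'[symmetric] powr_diff powr_minus divide_inverse mult_ac)
      finally show "(\<integral>\<^sup>+x. ennreal (cube_vol Q powr (- (e * p)) * w Q powr p') * indicator (dyadic_cube Q) x \<partial>lborel)
        = ennreal (cube_vol Q powr (1 - e * p) * w Q powr p')" .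
    qed
    finally have int_S: "(\<integral>\<^sup>+x. S x \<partial>lborel) = \<dots>" .
    have "epowr (f_norm s p q a) p = (\<integral>\<^sup>+x. epowr (lq_norm q UNIV (\<lambda>Q. ennreal (cube_vol Q powr (-e) * w Q) * indicator (dyadic_cube Q) x)) p \<partial>lborel)"
      unfolding epowr_f_norm[OF p, where e = e] w_def ..
    also have "\<dots> \<le> (\<integral>\<^sup>+x. ennreal (C * l powr (p - p')) * S x \<partial>lborel)"
      by (intro nn_integral_mono pt)
    also have "\<dots> = ennreal (C * l powr (p - p')) * (\<integral>\<^sup>+x. S x \<partial>lborel)"
      by (rule nn_integral_cmult) simp
    finally show "epowr (f_norm s p q a) p \<le> ennreal (C * l powr (p - p')) *
       (\<integral>\<^sup>+Q. ennreal (cube_vol Q powr (1 - e * p) *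
         (cube_vol Q powr (e - s / ?d - 1 / 2) * cmod (a Q)) powr p') \<partial>count_space UNIV)"
      unfolding int_S unfolding w_def .
  qed
qed

text \<open>The equation for \<open>e\<close> says that the powers of \<open>cube_vol Q\<close> on
  the two sides agree. It is used for \<open>\<gamma>\<close>, \<open>\<tau>\<close>, where it
  determines \<open>e\<close>, and for the target space, so that both b-norms share weights and
  coefficients.\<close>

lemma epowr_b_norm_weighted:
  fixes a :: "('d::finite) dyadic_seq"
  assumes "0 < r" and eq: "e * (p - r) = r * (\<sigma> - s) / real CARD('d)"
  shows "epowr (b_norm \<sigma> (ennreal r) (ennreal r) a) r =
    (\<integral>\<^sup>+Q. ennreal (cube_vol Q powr (1 - e * p) * (cube_vol Q powr (e - s / real CARD('d) - 1 / 2) * cmod (a Q)) powr r) \<partial>count_space UNIV)"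
  unfolding epowr_b_norm[OF assms(1)]
proof (rule nn_integral_cong)
  fix Q :: "'d dyadic"
  have "(- \<sigma> / real CARD('d) + 1 / r - 1 / 2) * r = 1 - e * p + (e - s / real CARD('d) - 1 / 2) * r"
    using eq assms(1) by (simp add: algebra_simps diff_divide_distrib)
  then have "cube_vol Q powr ((- \<sigma> / real CARD('d) + 1 / r - 1 / 2) * r)
     = cube_vol Q powr (1 - e * p) * cube_vol Q powr ((e - s / real CARD('d) - 1 / 2) * r)"
    by (simp only: powr_add)
  then show "ennreal ((cube_vol Q powr (- \<sigma> / real CARD('d) + 1 / r - 1 / 2) * cmod (a Q)) powr r) =
     ennreal (cube_vol Q powr (1 - e * p) * (cube_vol Q powr (e - s / real CARD('d) - 1 / 2) * cmod (a Q)) powr r)"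
    by (simp only: powr_mult powr_powr mult.assoc powr_ge_zero norm_ge_zero)
qed

lemma le_from_epowr_le:
  assumes "0 < r" "0 < C" "epowr x r \<le> ennreal C * epowr y r"
  shows "x \<le> ennreal (C powr (1 / r)) * y"
proof (rule epowr_le_cancel[OF assms(1)])
  show "epowr x r \<le> epowr (ennreal (C powr (1 / r)) * y) r"
    using assms by (simp add: epowr_mult powr_powr)
qed

theorem theorem2p11p1:
  fixes s \<gamma> p \<tau> \<theta> \<tau>\<theta> :: real and q :: ennreal
  assumes "0 < p" and "0 < q"
    and "0 < \<tau>" and "\<tau> < p"
    and "0 < \<theta>" and "\<theta> < 1"
    and "\<gamma> \<noteq> s"
    and "1 / \<tau>\<theta> = (1 - \<theta>) / p + \<theta> / \<tau>"
  shows "interp_space \<theta> (ennreal \<tau>\<theta>) (f_norm s p q) (b_norm \<gamma> (ennreal \<tau>) (ennreal \<tau>))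
           = (b_space ((1 - \<theta>) * s + \<theta> * \<gamma>) (ennreal \<tau>\<theta>) (ennreal \<tau>\<theta>) :: ('d::finite) dyadic_seq set)
       \<and> equivalent_on
           (b_space ((1 - \<theta>) * s + \<theta> * \<gamma>) (ennreal \<tau>\<theta>) (ennreal \<tau>\<theta>) :: 'd dyadic_seq set)
           (interp_norm \<theta> (ennreal \<tau>\<theta>) (f_norm s p q) (b_norm \<gamma> (ennreal \<tau>) (ennreal \<tau>)))
           (b_norm ((1 - \<theta>) * s + \<theta> * \<gamma>) (ennreal \<tau>\<theta>) (ennreal \<tau>\<theta>))"
proof -
  let ?d = "real CARD('d)"
  let ?I = "interp_norm \<theta> (ennreal \<tau>\<theta>) (f_norm s p q) (b_norm \<gamma> (ennreal \<tau>) (ennreal \<tau>)) :: 'd dyadic_seq \<Rightarrow> ennreal"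
  let ?B = "b_norm ((1 - \<theta>) * s + \<theta> * \<gamma>) (ennreal \<tau>\<theta>) (ennreal \<tau>\<theta>) :: 'd dyadic_seq \<Rightarrow> ennreal"
  define r where "r = \<tau>\<theta>"
  \<comment> \<open>The exponent for which rescaling the coefficients by \<open>cube_vol Q powr e\<close> turns all the \<open>b\<close>-norms
    involved into weighted \<open>\<ell>\<close>-norms with the same weight \<open>cube_vol Q powr (1 - e * p)\<close>.
    Only \<open>e \<noteq> 0\<close>, i.e. \<open>\<gamma> \<noteq> s\<close>, makes the terms of the \<open>f\<close>-norm at a point lacunary.\<close>
  define e where "e = (\<gamma> - s) / ?d * \<tau> / (p - \<tau>)"
  have e: "e \<noteq> 0" using assms by (simp add: e_def)
  have r_pos: "0 < r"
  proof -
    have "1 / r > 0" unfolding r_def assms(8) using assms by (intro add_pos_pos) auto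
    then show ?thesis by simp
  qed
  have r_less: "r < p"
  proof -
    have "\<theta> / p < \<theta> / \<tau>" using assms by (intro divide_strict_left_mono) auto
    then have "1 / p < 1 / r" unfolding r_def assms(8) by (simp add: diff_divide_distrib)
    then show ?thesis using assms r_pos by (simp add: field_simps)
  qed
  \<comment> \<open>An exponent strictly between \<open>r\<close> and \<open>p\<close>:
    \<open>r < p'\<close> makes the integral of \<open>\<Phi>\<close> converge at infinity, and
    \<open>p' < p\<close> gives the decay in \<open>lacunary_bounded_bound\<close>.\<close>
  define p' where "p' = (r + p) / 2"
  have p': "r < p'" "p' < p" "0 < p'" using r_less r_pos by (auto simp: p'_def)
  obtain C where C: "0 < C" "\<And>(a :: 'd dyadic_seq) l. 0 < l \<Longrightarrow>
     ennreal (l powr p) * (\<integral>\<^sup>+Q. ennreal (cube_vol Q powr (1 - e * p)) *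
         indicator {Q. l < cube_vol Q powr (e - s / ?d - 1 / 2) * cmod (a Q)} Q \<partial>count_space UNIV)
     \<le> ennreal C * epowr (f_norm s p q a) p"
    by (rule f_norm_weak[OF e assms(1,2)]) blast
  obtain C' where C': "0 < C'" "\<And>(a :: 'd dyadic_seq) l. 0 < l \<Longrightarrow>
     (\<And>Q. cube_vol Q powr (e - s / ?d - 1 / 2) * cmod (a Q) \<le> l) \<Longrightarrow>
     epowr (f_norm s p q a) p \<le> ennreal (C' * l powr (p - p')) *
       (\<integral>\<^sup>+Q. ennreal (cube_vol Q powr (1 - e * p) *
         (cube_vol Q powr (e - s / ?d - 1 / 2) * cmod (a Q)) powr p') \<partial>count_space UNIV)"
    by (rule f_norm_bounded[OF e p'(3,2) assms(2)]) blast
  have e_tau: "e * (p - \<tau>) = \<tau> * (\<gamma> - s) / ?d"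
    using assms by (simp add: e_def)
  \<comment> \<open>The same \<open>e\<close> fits the target space: its smoothness exceeds
    \<open>s\<close> by \<open>\<theta> * (\<gamma> - s)\<close>, and clearing denominators in the
    definition of \<open>r\<close> gives
    \<open>(p - r) * \<tau> = \<theta> * r * (p - \<tau>)\<close>.\<close>
  have e_r: "e * (p - r) = r * (((1 - \<theta>) * s + \<theta> * \<gamma>) - s) / ?d"
  proof -
    have "(p - r) * \<tau> = \<theta> * r * (p - \<tau>)"
    proof -
      have "p * \<tau> = p * \<tau> * r * (1 / r)" using r_pos by simp
      also have "\<dots> = p * \<tau> * r * ((1 - \<theta>) / p + \<theta> / \<tau>)"
        using assms(8) by (simp only: r_def)
      also have "\<dots> = \<tau> * r * (1 - \<theta>) + p * r * \<theta>"
        using assms(1,3) by (simp add: distrib_left)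
      finally show ?thesis by (simp add: algebra_simps)
    qed
    moreover have "e * (p - r) = (\<gamma> - s) / ?d * ((p - r) * \<tau>) / (p - \<tau>)"
      by (simp add: e_def)
    ultimately have "e * (p - r) = (\<gamma> - s) / ?d * (\<theta> * r * (p - \<tau>)) / (p - \<tau>)"
      by (simp only:)
    also have "\<dots> = (\<gamma> - s) / ?d * (\<theta> * r)" using assms by simp
    finally show ?thesis by (simp add: algebra_simps)
  qed
  interpret weak_type_couple "\<lambda>Q :: 'd dyadic. cube_vol Q powr (1 - e * p)"
     "\<lambda>Q. cube_vol Q powr (e - s / ?d - 1 / 2)" "f_norm s p q"
     "b_norm \<gamma> (ennreal \<tau>) (ennreal \<tau>)" p \<tau> \<theta> r p' C C'
    by unfold_locales
      (use assms p' C C' epowr_b_norm_weighted[OF assms(3) e_tau] in \<open>simp_all add: r_def\<close>)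
  note B = epowr_b_norm_weighted[OF r_pos e_r, unfolded r_def]
  define k where "k = 1 / (\<alpha> * c0 powr r)"
  define K where "K = c1 powr r / \<alpha> * (r / (r - \<tau>) + r / (p' - r))"
  have k: "0 < k" using alpha_pos c0_pos by (simp add: k_def)
  have K: "0 < K" unfolding K_def
    using alpha_pos c1_pos r_pos tau_less_r p' by (intro mult_pos_pos add_pos_pos) auto
  have low: "?B a \<le> ennreal ((1 / k) powr (1 / r)) * ?I a" for a
  proof (rule le_from_epowr_le[OF r_pos])
    have "ennreal k * epowr (?B a) r \<le> epowr (?I a) r"
      using le_interp_norm[of a] unfolding k_def r_def B .
    then have "ennreal (1 / k) * (ennreal k * epowr (?B a) r) \<le> ennreal (1 / k) * epowr (?I a) r"
      by (rule mult_left_mono) simp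
    then show "epowr (?B a) r \<le> ennreal (1 / k) * epowr (?I a) r"
      using k by (simp add: mult.assoc[symmetric] ennreal_mult'[symmetric])
  qed (use k in simp)
  have up: "?I a \<le> ennreal (K powr (1 / r)) * ?B a" for a
    using interp_norm_le[of a] unfolding K_def[symmetric]
    by (intro le_from_epowr_le[OF r_pos K]) (simp only: r_def B)
  \<comment> \<open>\<open>low\<close> and \<open>up\<close> hold for all sequences, infinite values
    included, and therefore yield the equality of the spaces as well as the equivalence of the
    quasi-norms.\<close>
  have "?I a < \<infinity> \<longleftrightarrow> ?B a < \<infinity>" for a
    using low[of a] up[of a] by (metis ennreal_mult_less_top ennreal_less_top infinity_ennreal_def le_less_trans)
  then have "interp_space \<theta> (ennreal \<tau>\<theta>) (f_norm s p q) (b_norm \<gamma> (ennreal \<tau>) (ennreal \<tau>))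
      = (b_space ((1 - \<theta>) * s + \<theta> * \<gamma>) (ennreal \<tau>\<theta>) (ennreal \<tau>\<theta>) :: 'd dyadic_seq set)"
    by (simp add: interp_space_def b_space_def)
  moreover have "equivalent_on (b_space ((1 - \<theta>) * s + \<theta> * \<gamma>) (ennreal \<tau>\<theta>) (ennreal \<tau>\<theta>) :: 'd dyadic_seq set) ?I ?B"
    unfolding equivalent_on_def
  proof (intro exI conjI ballI)
    show "0 < 1 / K powr (1 / r)" "0 < (1 / k) powr (1 / r)" using k K by auto
    fix a
    have "ennreal (1 / K powr (1 / r)) * ?I a \<le> ennreal (1 / K powr (1 / r)) * (ennreal (K powr (1 / r)) * ?B a)"
      by (intro mult_left_mono up) simp
    also have "\<dots> = ?B a"
      using K by (simp add: mult.assoc[symmetric] ennreal_mult'[symmetric])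
    finally show "ennreal (1 / K powr (1 / r)) * ?I a \<le> ?B a" .
    show "?B a \<le> ennreal ((1 / k) powr (1 / r)) * ?I a" by (rule low)
  qed
  ultimately show ?thesis ..
qed

end
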